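(* Let $\mathcal K$ be $\mathsf{Met}$ or $\mathsf{UMet}$. Every strongly finitary monad $\mathbb T$ on $\mathcal K$ is (up to isomorphism of monads) the free-algebra monad of the variety $\mathcal V_{\mathbb T}$ of quantitative algebras (if $\mathcal K=\mathsf{Met}$) or ultra-quantitative algebras (if $\mathcal K=\mathsf{UMet}$) associated with $\mathbb T$.
   Context: $\mathsf{Met}$ is the category of extended metric spaces (distance $\infty$ allowed) and nonexpanding maps; $\mathsf{UMet}$ is its full subcategory of ultrametric spaces ($d(x,z)\le\max\{d(x,y),d(y,z)\}$). Hom-sets carry the supremum metric; functors and monads are enriched (nonexpanding on hom-spaces). Every set is regarded as a discrete space (distances $0$ or $\infty$). An enriched endofunctor $T$ of $\mathcal K$ is strongly finitary if it is the enriched left Kan extension $T=\mathrm{Lan}_K(T\circ K)$ of its restriction along the full embedding $K:\mathsf{Set}_{\mathrm{fp}}\hookrightarrow\mathcal K$ of finite discrete spaces. A monad is strongly finitary if its endofunctor is. A finitary signature $\Sigma$ is a set of operation symbols with arities in $\mathbb N$. A quantitative $\Sigma$-algebra is a metric space $A$ with nonexpanding operations $\sigma_A:A^n\to A$ ($A^n$ with the maximum metric) for $n$-ary $\sigma\in\Sigma$; it is ultra-quantitative if $A$ is ultrametric. Homomorphisms are nonexpanding maps preserving operations. With $V=\{x_k\mid k\in\mathbb N\}$ a set of variables and $T_\Sigma V$ the algebra of terms, a quantitative equation is $l=_\varepsilon r$ with $l,r\in T_\Sigma V$, $\varepsilon\ge0$ rational ($l=r$ means $l=_0r$); $A$ satisfies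 it if $d(f^\sharp(l),f^\sharp(r))\le\varepsilon$ for every map $f:V\to|A|$, where $f^\sharp$ is the homomorphic extension. A variety is the full subcategory of (ultra-)quantitative $\Sigma$-algebras satisfying a given set of quantitative equations. For every variety $\mathcal V$ the forgetful functor $U:\mathcal V\to\mathcal K$ has a left adjoint $F$; the free-algebra monad of $\mathcal V$ is the resulting monad on $\mathcal K$, carried by $UF$. The variety $\mathcal V_{\mathbb T}$ associated with $\mathbb T=(T,\mu,\eta)$: put $V_n=\{x_k\mid k<n\}$ (discrete). For a map $k:V_n\to TV_m$ let $k^*=\mu_{V_m}\circ Tk:TV_n\to TV_m$. The signature $\Sigma$ has as set of $n$-ary symbols $\Sigma_n=|TV_n|$ (for each $n\in\mathbb N$). An $n$-ary symbol $\sigma\in|TV_n|$ is identified with the term $\sigma(x_i)_{i<n}\in T_\Sigma V_n$. $\mathcal V_{\mathbb T}$ is presented by the following equations, for all $n,m\in\mathbb N$: (1) $l=_\varepsilon r$ for all $l,r\in TV_n$ with $d(l,r)\le\varepsilon$ in $TV_n$; (2) $k^*(\sigma)=\sigma(k(x_i))_{i<n}$ for all $\sigma\in TV_n$ and all maps $k:V_n\to|TV_m|$ (the left side is the $m$-ary symbol $k^*(\sigma)\in TV_m$, the right side is the composite term with the $m$-ary symbols $k(x_i)$, all viewed as terms in $T_\Sigma V_m$); (3) $\eta_{V_n}(x_i)=x_i$ for all $i<n$. *)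

theory Defs
  imports "HOL-Library.FuncSet" "HOL-Library.Extended_Nonnegative_Real"
begin

section \<open>Extended metric spaces\<close>

text \<open>
  A space has its points in a fixed ambient type. Distances involving elements outside the carrier
  are normalised to 0, and morphisms are extensional functions, so equality of HOL terms is
  equality of spaces and of morphisms, respectively.
\<close>

record 'u emetric =
  pts :: "'u set"
  edst :: "'u \<Rightarrow> 'u \<Rightarrow> ennreal"

definition ext_metric :: "'u emetric \<Rightarrow> bool" where
  "ext_metric X \<longleftrightarrow>
     (\<forall>x\<in>pts X. \<forall>y\<in>pts X. edst X x y = 0 \<longleftrightarrow> x = y) \<and>
     (\<forall>x\<in>pts X. \<forall>y\<in>pts X. edst X x y = edst X y x) \<and>
     (\<forall>x\<in>pts X. \<forall>y\<in>pts X. \<forall>z\<in>pts X. edst X x z \<le> edst X x y + edst X y z) \<and>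
     (\<forall>x y. x \<notin> pts X \<or> y \<notin> pts X \<longrightarrow> edst X x y = 0)"

definition ultrametric :: "'u emetric \<Rightarrow> bool" where
  "ultrametric X \<longleftrightarrow>
     (\<forall>x\<in>pts X. \<forall>y\<in>pts X. \<forall>z\<in>pts X. edst X x z \<le> max (edst X x y) (edst X y z))"

definition disc :: "'u set \<Rightarrow> 'u emetric" where
  "disc A = \<lparr>pts = A, edst = (\<lambda>x y. if x \<in> A \<and> y \<in> A \<and> x \<noteq> y then \<infinity> else 0)\<rparr>"

text \<open>
  \<open>U\<close> is the collection of ``small'' subsets of the ambient type, i.e. of the admissible underlying
  sets of spaces. For an ambient type of (strongly) inaccessible cardinality \<open>\<kappa>\<close> and \<open>U\<close> the subsets of
  cardinality less than \<open>\<kappa>\<close> this is a universe of sets in the usual sense; \<open>U = UNIV\<close> yields all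
  spaces with points in the ambient type. No closure properties beyond these two are required.
\<close>

definition small_sets :: "'u set set \<Rightarrow> bool" where
  "small_sets U \<longleftrightarrow> (\<forall>A\<in>U. \<forall>B. B \<subseteq> A \<longrightarrow> B \<in> U) \<and> (\<forall>A. finite A \<longrightarrow> A \<in> U)"

text \<open>
  The base category \<open>Met\<close> and its full subcategory \<open>UMet\<close> are given by their classes of objects;
  the morphisms are always those of \<open>nex\<close> below.
\<close>

definition Met :: "'u set set \<Rightarrow> 'u emetric set" where
  "Met U = {X. ext_metric X \<and> pts X \<in> U}"

definition UMet :: "'u set set \<Rightarrow> 'u emetric set" where
  "UMet U = {X \<in> Met U. ultrametric X}"

definition nex :: "'u emetric \<Rightarrow> 'u emetric \<Rightarrow> ('u \<Rightarrow> 'u) set" where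
  "nex X Y = {f \<in> pts X \<rightarrow>\<^sub>E pts Y.
     \<forall>x\<in>pts X. \<forall>y\<in>pts X. edst Y (f x) (f y) \<le> edst X x y}"

abbreviation ident :: "'u emetric \<Rightarrow> 'u \<Rightarrow> 'u" where
  "ident X \<equiv> (\<lambda>x\<in>pts X. x)"

definition sup_dst :: "'u emetric \<Rightarrow> 'u emetric \<Rightarrow> ('u \<Rightarrow> 'u) \<Rightarrow> ('u \<Rightarrow> 'u) \<Rightarrow> ennreal" where
  "sup_dst X Y f g = (SUP x\<in>pts X. edst Y (f x) (g x))"


section \<open>Enriched functors and monads\<close>

record 'u efun =
  fob :: "'u emetric \<Rightarrow> 'u emetric"
  fmp :: "'u emetric \<Rightarrow> 'u emetric \<Rightarrow> ('u \<Rightarrow> 'u) \<Rightarrow> 'u \<Rightarrow> 'u"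

definition enriched_functor :: "'u emetric set \<Rightarrow> 'u emetric set \<Rightarrow> ('u, 'm) efun_scheme \<Rightarrow> bool" where
  "enriched_functor C K T \<longleftrightarrow>
     (\<forall>X\<in>C. fob T X \<in> K) \<and>
     (\<forall>X\<in>C. \<forall>Y\<in>C. \<forall>f\<in>nex X Y. fmp T X Y f \<in> nex (fob T X) (fob T Y)) \<and>
     (\<forall>X\<in>C. fmp T X X (ident X) = ident (fob T X)) \<and>
     (\<forall>X\<in>C. \<forall>Y\<in>C. \<forall>Z\<in>C. \<forall>f\<in>nex X Y. \<forall>g\<in>nex Y Z.
        fmp T X Z (compose (pts X) g f) =
        compose (pts (fob T X)) (fmp T Y Z g) (fmp T X Y f)) \<and>
     (\<forall>X\<in>C. \<forall>Y\<in>C. \<forall>f\<in>nex X Y. \<forall>g\<in>nex X Y.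
        sup_dst (fob T X) (fob T Y) (fmp T X Y f) (fmp T X Y g) \<le> sup_dst X Y f g)"

record 'u emonad = "'u efun" +
  mu :: "'u emetric \<Rightarrow> 'u \<Rightarrow> 'u"
  eta :: "'u emetric \<Rightarrow> 'u \<Rightarrow> 'u"

definition enriched_monad :: "'u emetric set \<Rightarrow> 'u emonad \<Rightarrow> bool" where
  "enriched_monad K T \<longleftrightarrow>
     enriched_functor K K T \<and>
     (\<forall>X\<in>K. eta T X \<in> nex X (fob T X)) \<and>
     (\<forall>X\<in>K. mu T X \<in> nex (fob T (fob T X)) (fob T X)) \<and>
     (\<forall>X\<in>K. \<forall>Y\<in>K. \<forall>f\<in>nex X Y.
        compose (pts X) (eta T Y) f = compose (pts X) (fmp T X Y f) (eta T X)) \<and>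
     (\<forall>X\<in>K. \<forall>Y\<in>K. \<forall>f\<in>nex X Y.
        compose (pts (fob T (fob T X))) (mu T Y) (fmp T (fob T X) (fob T Y) (fmp T X Y f)) =
        compose (pts (fob T (fob T X))) (fmp T X Y f) (mu T X)) \<and>
     (\<forall>X\<in>K. compose (pts (fob T X)) (mu T X) (eta T (fob T X)) = ident (fob T X)) \<and>
     (\<forall>X\<in>K. compose (pts (fob T X)) (mu T X) (fmp T X (fob T X) (eta T X)) = ident (fob T X)) \<and>
     (\<forall>X\<in>K. compose (pts (fob T (fob T (fob T X)))) (mu T X) (mu T (fob T X)) =
             compose (pts (fob T (fob T (fob T X)))) (mu T X)
               (fmp T (fob T (fob T X)) (fob T X) (mu T X)))"

definition monad_iso :: "'u emetric set \<Rightarrow> 'u emonad \<Rightarrow> 'u emonad \<Rightarrow> bool" where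
  "monad_iso K S T \<longleftrightarrow> (\<exists>\<phi> \<psi>.
     (\<forall>X\<in>K. \<phi> X \<in> nex (fob S X) (fob T X) \<and> \<psi> X \<in> nex (fob T X) (fob S X) \<and>
        compose (pts (fob S X)) (\<psi> X) (\<phi> X) = ident (fob S X) \<and>
        compose (pts (fob T X)) (\<phi> X) (\<psi> X) = ident (fob T X)) \<and>
     (\<forall>X\<in>K. \<forall>Y\<in>K. \<forall>f\<in>nex X Y.
        compose (pts (fob S X)) (\<phi> Y) (fmp S X Y f) =
        compose (pts (fob S X)) (fmp T X Y f) (\<phi> X)) \<and>
     (\<forall>X\<in>K. compose (pts X) (\<phi> X) (eta S X) = eta T X) \<and>
     (\<forall>X\<in>K. compose (pts (fob S (fob S X))) (\<phi> X) (mu S X) =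
        compose (pts (fob S (fob S X))) (mu T X)
          (compose (pts (fob S (fob S X))) (fmp T (fob S X) (fob T X) (\<phi> X)) (\<phi> (fob S X)))))"


section \<open>Strongly finitary monads\<close>

text \<open>Finite sets, viewed as discrete spaces.\<close>

definition FinDisc :: "'u emetric set" where
  "FinDisc = {disc A | A. finite A}"

text \<open>
  For \<open>G\<close> a functor on \<open>FinDisc\<close>, \<open>presheaf_nat G X Y\<close> is the set of enriched natural transformations
  from the presheaf \<open>nex _ X\<close> on \<open>FinDisc\<close> to the presheaf \<open>nex (G _) Y\<close>.
\<close>

definition presheaf_nat ::
    "('u, 'm) efun_scheme \<Rightarrow> 'u emetric \<Rightarrow> 'u emetric \<Rightarrow>
     ('u emetric \<Rightarrow> ('u \<Rightarrow> 'u) \<Rightarrow> 'u \<Rightarrow> 'u) set" where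
  "presheaf_nat G X Y = {\<alpha> \<in> (\<Pi>\<^sub>E D\<in>FinDisc. nex D X \<rightarrow>\<^sub>E nex (fob G D) Y).
     (\<forall>D\<in>FinDisc. \<forall>a\<in>nex D X. \<forall>b\<in>nex D X.
        sup_dst (fob G D) Y (\<alpha> D a) (\<alpha> D b) \<le> sup_dst D X a b) \<and>
     (\<forall>D\<in>FinDisc. \<forall>D'\<in>FinDisc. \<forall>u\<in>nex D' D. \<forall>a\<in>nex D X.
        \<alpha> D' (compose (pts D') a u) =
        compose (pts (fob G D')) (\<alpha> D a) (fmp G D' D u))}"

definition presheaf_dst ::
    "('u, 'm) efun_scheme \<Rightarrow> 'u emetric \<Rightarrow> 'u emetric \<Rightarrow>
     ('u emetric \<Rightarrow> ('u \<Rightarrow> 'u) \<Rightarrow> 'u \<Rightarrow> 'u) \<Rightarrow>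
     ('u emetric \<Rightarrow> ('u \<Rightarrow> 'u) \<Rightarrow> 'u \<Rightarrow> 'u) \<Rightarrow> ennreal" where
  "presheaf_dst G X Y \<alpha> \<beta> =
     (SUP D\<in>FinDisc. SUP a\<in>nex D X. sup_dst (fob G D) Y (\<alpha> D a) (\<beta> D a))"

definition lan_comparison ::
    "('u, 'm) efun_scheme \<Rightarrow> ('u, 'l) efun_scheme \<Rightarrow> ('u emetric \<Rightarrow> 'u \<Rightarrow> 'u) \<Rightarrow>
     'u emetric \<Rightarrow> ('u \<Rightarrow> 'u) \<Rightarrow> 'u emetric \<Rightarrow> ('u \<Rightarrow> 'u) \<Rightarrow> 'u \<Rightarrow> 'u" where
  "lan_comparison G L \<gamma> X h =
     (\<lambda>D\<in>FinDisc. \<lambda>a\<in>nex D X.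
        compose (pts (fob G D)) h (compose (pts (fob G D)) (fmp L D X a) (\<gamma> D)))"

text \<open>
  The natural transformation \<open>\<gamma>\<close> from \<open>G\<close> to the restriction of \<open>L\<close> exhibits \<open>L\<close> as the
  (pointwise) enriched left Kan extension of \<open>G\<close> along the embedding of \<open>FinDisc\<close> into \<open>K\<close>: every
  \<open>L X\<close> is the colimit of \<open>G\<close> weighted by \<open>nex _ X\<close>, i.e. there are isomorphisms of metric spaces
  between \<open>nex (L X) Y\<close> and \<open>presheaf_nat G X Y\<close>, induced by \<open>\<gamma>\<close>.
\<close>

definition enriched_Lan ::
    "'u emetric set \<Rightarrow> ('u, 'm) efun_scheme \<Rightarrow> ('u, 'l) efun_scheme \<Rightarrow>
     ('u emetric \<Rightarrow> 'u \<Rightarrow> 'u) \<Rightarrow> bool" where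
  "enriched_Lan K G L \<gamma> \<longleftrightarrow>
     enriched_functor FinDisc K G \<and> enriched_functor K K L \<and>
     (\<forall>D\<in>FinDisc. \<gamma> D \<in> nex (fob G D) (fob L D)) \<and>
     (\<forall>D\<in>FinDisc. \<forall>D'\<in>FinDisc. \<forall>u\<in>nex D D'.
        compose (pts (fob G D)) (\<gamma> D') (fmp G D D' u) =
        compose (pts (fob G D)) (fmp L D D' u) (\<gamma> D)) \<and>
     (\<forall>X\<in>K. \<forall>Y\<in>K.
        bij_betw (lan_comparison G L \<gamma> X) (nex (fob L X) Y) (presheaf_nat G X Y) \<and>
        (\<forall>h\<in>nex (fob L X) Y. \<forall>h'\<in>nex (fob L X) Y.
           presheaf_dst G X Y (lan_comparison G L \<gamma> X h) (lan_comparison G L \<gamma> X h') =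
           sup_dst (fob L X) Y h h'))"

text \<open>
  \<open>T\<close> is the left Kan extension of its restriction. Since \<open>enriched_Lan\<close> uses its second argument
  only at objects of \<open>FinDisc\<close>, the restriction of \<open>T\<close> is represented by \<open>T\<close> itself.
\<close>

definition strongly_finitary :: "'u emetric set \<Rightarrow> ('u, 'm) efun_scheme \<Rightarrow> bool" where
  "strongly_finitary K T \<longleftrightarrow> enriched_Lan K T T (\<lambda>D. ident (fob T D))"


section \<open>Quantitative algebras and varieties\<close>

record 's signature =
  syms :: "'s set"
  arity :: "'s \<Rightarrow> nat"

record ('u, 's) qalg =
  sp :: "'u emetric"
  op_of :: "'s \<Rightarrow> 'u list \<Rightarrow> 'u"

text \<open>The \<open>n\<close>-th power of a set consists of lists of length \<open>n\<close>.\<close>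

definition tuples :: "nat \<Rightarrow> 'u set \<Rightarrow> 'u list set" where
  "tuples n A = {as. length as = n \<and> set as \<subseteq> A}"

definition tuple_dst :: "'u emetric \<Rightarrow> 'u list \<Rightarrow> 'u list \<Rightarrow> ennreal" where
  "tuple_dst X as bs = (SUP i\<in>{..<length as}. edst X (as ! i) (bs ! i))"

definition quant_alg :: "'u emetric set \<Rightarrow> 's signature \<Rightarrow> ('u, 's) qalg \<Rightarrow> bool" where
  "quant_alg K \<Sigma> A \<longleftrightarrow>
     sp A \<in> K \<and>
     (\<forall>s\<in>syms \<Sigma>. \<forall>as\<in>tuples (arity \<Sigma> s) (pts (sp A)). op_of A s as \<in> pts (sp A)) \<and>
     (\<forall>s\<in>syms \<Sigma>. \<forall>as\<in>tuples (arity \<Sigma> s) (pts (sp A)). \<forall>bs\<in>tuples (arity \<Sigma> s) (pts (sp A)).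
        edst (sp A) (op_of A s as) (op_of A s bs) \<le> tuple_dst (sp A) as bs) \<and>
     (\<forall>s as. s \<notin> syms \<Sigma> \<or> as \<notin> tuples (arity \<Sigma> s) (pts (sp A)) \<longrightarrow> op_of A s as = undefined)"

definition alg_hom :: "'s signature \<Rightarrow> ('u, 's) qalg \<Rightarrow> ('u, 's) qalg \<Rightarrow> ('u \<Rightarrow> 'u) set" where
  "alg_hom \<Sigma> A B = {h \<in> nex (sp A) (sp B).
     \<forall>s\<in>syms \<Sigma>. \<forall>as\<in>tuples (arity \<Sigma> s) (pts (sp A)).
       h (op_of A s as) = op_of B s (map h as)}"

text \<open>\<open>Var k\<close> is the variable \<open>x\<^sub>k\<close>.\<close>

datatype 's tm = Var nat | App 's "'s tm list"

inductive_set terms :: "'s signature \<Rightarrow> 's tm set" for \<Sigma> where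
  "Var k \<in> terms \<Sigma>"
| "s \<in> syms \<Sigma> \<Longrightarrow> length ts = arity \<Sigma> s \<Longrightarrow> (\<And>t. t \<in> set ts \<Longrightarrow> t \<in> terms \<Sigma>) \<Longrightarrow> App s ts \<in> terms \<Sigma>"

primrec term_val :: "('u, 's) qalg \<Rightarrow> (nat \<Rightarrow> 'u) \<Rightarrow> 's tm \<Rightarrow> 'u" where
  "term_val A f (Var k) = f k"
| "term_val A f (App s ts) = op_of A s (map (term_val A f) ts)"

text \<open>The triple \<open>(l, \<epsilon>, r)\<close> stands for the quantitative equation \<open>l =\<^sub>\<epsilon> r\<close>.\<close>

type_synonym 's qeq = "'s tm \<times> rat \<times> 's tm"

definition quant_eqs :: "'s signature \<Rightarrow> 's qeq set" where
  "quant_eqs \<Sigma> = {(l, \<epsilon>, r). l \<in> terms \<Sigma> \<and> r \<in> terms \<Sigma> \<and> \<epsilon> \<ge> 0}"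

definition satisfies :: "('u, 's) qalg \<Rightarrow> 's qeq \<Rightarrow> bool" where
  "satisfies A e = (case e of (l, \<epsilon>, r) \<Rightarrow>
     \<forall>f. range f \<subseteq> pts (sp A) \<longrightarrow>
       edst (sp A) (term_val A f l) (term_val A f r) \<le> ennreal (of_rat \<epsilon>))"

definition variety :: "'u emetric set \<Rightarrow> 's signature \<Rightarrow> 's qeq set \<Rightarrow> ('u, 's) qalg set" where
  "variety K \<Sigma> E = {A. quant_alg K \<Sigma> A \<and> (\<forall>e\<in>E. satisfies A e)}"


section \<open>Free-algebra monads\<close>

text \<open>Data of a left adjoint to the forgetful functor \<open>sp\<close>, together with unit and counit.\<close>

record ('u, 's) free_adj =
  free_ob :: "'u emetric \<Rightarrow> ('u, 's) qalg"
  free_mp :: "'u emetric \<Rightarrow> 'u emetric \<Rightarrow> ('u \<Rightarrow> 'u) \<Rightarrow> 'u \<Rightarrow> 'u"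
  adj_unit :: "'u emetric \<Rightarrow> 'u \<Rightarrow> 'u"
  adj_counit :: "('u, 's) qalg \<Rightarrow> 'u \<Rightarrow> 'u"

text \<open>\<open>\<V>\<close> is a class of \<open>\<Sigma>\<close>-algebras, regarded as a full subcategory.\<close>

definition free_adjunction ::
    "'u emetric set \<Rightarrow> 's signature \<Rightarrow> ('u, 's) qalg set \<Rightarrow> ('u, 's) free_adj \<Rightarrow> bool" where
  "free_adjunction K \<Sigma> \<V> F \<longleftrightarrow>
     (\<forall>X\<in>K. free_ob F X \<in> \<V>) \<and>
     (\<forall>X\<in>K. \<forall>Y\<in>K. \<forall>f\<in>nex X Y. free_mp F X Y f \<in> alg_hom \<Sigma> (free_ob F X) (free_ob F Y)) \<and>
     (\<forall>X\<in>K. free_mp F X X (ident X) = ident (sp (free_ob F X))) \<and>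
     (\<forall>X\<in>K. \<forall>Y\<in>K. \<forall>Z\<in>K. \<forall>f\<in>nex X Y. \<forall>g\<in>nex Y Z.
        free_mp F X Z (compose (pts X) g f) =
        compose (pts (sp (free_ob F X))) (free_mp F Y Z g) (free_mp F X Y f)) \<and>
     (\<forall>X\<in>K. \<forall>Y\<in>K. \<forall>f\<in>nex X Y. \<forall>g\<in>nex X Y.
        sup_dst (sp (free_ob F X)) (sp (free_ob F Y)) (free_mp F X Y f) (free_mp F X Y g)
        \<le> sup_dst X Y f g) \<and>
     (\<forall>X\<in>K. adj_unit F X \<in> nex X (sp (free_ob F X))) \<and>
     (\<forall>X\<in>K. \<forall>Y\<in>K. \<forall>f\<in>nex X Y.
        compose (pts X) (adj_unit F Y) f = compose (pts X) (free_mp F X Y f) (adj_unit F X)) \<and>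
     (\<forall>A\<in>\<V>. adj_counit F A \<in> alg_hom \<Sigma> (free_ob F (sp A)) A) \<and>
     (\<forall>A\<in>\<V>. \<forall>B\<in>\<V>. \<forall>h\<in>alg_hom \<Sigma> A B.
        compose (pts (sp (free_ob F (sp A)))) (adj_counit F B) (free_mp F (sp A) (sp B) h) =
        compose (pts (sp (free_ob F (sp A)))) h (adj_counit F A)) \<and>
     (\<forall>X\<in>K. compose (pts (sp (free_ob F X))) (adj_counit F (free_ob F X))
               (free_mp F X (sp (free_ob F X)) (adj_unit F X)) = ident (sp (free_ob F X))) \<and>
     (\<forall>A\<in>\<V>. compose (pts (sp A)) (adj_counit F A) (adj_unit F (sp A)) = ident (sp A))"

definition adj_monad :: "('u, 's) free_adj \<Rightarrow> 'u emonad" where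
  "adj_monad F = \<lparr>fob = (\<lambda>X. sp (free_ob F X)), fmp = free_mp F,
     mu = (\<lambda>X. adj_counit F (free_ob F X)), eta = adj_unit F\<rparr>"


section \<open>The variety associated with a monad\<close>

text \<open>
  The sequence \<open>x\<close> (assumed injective) provides the points \<open>x\<^sub>k\<close> of the spaces \<open>V\<^sub>n\<close>. The point
  \<open>x i\<close> corresponds to the term \<open>Var i\<close>. An \<open>n\<close>-ary symbol is a pair \<open>(n, \<sigma>)\<close> with \<open>\<sigma>\<close> a point
  of \<open>T V\<^sub>n\<close>, as the sets of points of the \<open>T V\<^sub>n\<close> need not be disjoint.
\<close>

definition Vsp :: "(nat \<Rightarrow> 'u) \<Rightarrow> nat \<Rightarrow> 'u emetric" where
  "Vsp x n = disc (x ` {..<n})"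

definition assoc_sig :: "(nat \<Rightarrow> 'u) \<Rightarrow> 'u emonad \<Rightarrow> (nat \<times> 'u) signature" where
  "assoc_sig x T = \<lparr>syms = {(n, \<sigma>). \<sigma> \<in> pts (fob T (Vsp x n))}, arity = fst\<rparr>"

definition sym_tm :: "nat \<Rightarrow> 'u \<Rightarrow> (nat \<times> 'u) tm" where
  "sym_tm n \<sigma> = App (n, \<sigma>) (map Var [0..<n])"

definition kl_ext :: "(nat \<Rightarrow> 'u) \<Rightarrow> 'u emonad \<Rightarrow> nat \<Rightarrow> nat \<Rightarrow> ('u \<Rightarrow> 'u) \<Rightarrow> 'u \<Rightarrow> 'u" where
  "kl_ext x T n m k =
     compose (pts (fob T (Vsp x n))) (mu T (Vsp x m)) (fmp T (Vsp x n) (fob T (Vsp x m)) k)"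

definition assoc_eqs :: "(nat \<Rightarrow> 'u) \<Rightarrow> 'u emonad \<Rightarrow> (nat \<times> 'u) qeq set" where
  "assoc_eqs x T =
     {(sym_tm n l, \<epsilon>, sym_tm n r) | n l r \<epsilon>.
        l \<in> pts (fob T (Vsp x n)) \<and> r \<in> pts (fob T (Vsp x n)) \<and> \<epsilon> \<ge> 0 \<and>
        edst (fob T (Vsp x n)) l r \<le> ennreal (of_rat \<epsilon>)} \<union>
     {(sym_tm m (kl_ext x T n m k \<sigma>), 0, App (n, \<sigma>) (map (\<lambda>i. sym_tm m (k (x i))) [0..<n])) | n m \<sigma> k.
        \<sigma> \<in> pts (fob T (Vsp x n)) \<and> k \<in> pts (Vsp x n) \<rightarrow>\<^sub>E pts (fob T (Vsp x m))} \<union>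
     {(sym_tm n (eta T (Vsp x n) (x i)), 0, Var i) | n i. i < n}"

definition assoc_variety ::
    "'u emetric set \<Rightarrow> (nat \<Rightarrow> 'u) \<Rightarrow> 'u emonad \<Rightarrow> ('u, nat \<times> 'u) qalg set" where
  "assoc_variety K x T = variety K (assoc_sig x T) (assoc_eqs x T)"


section \<open>Well-formedness of the presentation\<close>

lemma finite_disc_in_UMet:
  assumes "small_sets U" "finite A"
  shows "disc A \<in> UMet U"
  using assms unfolding small_sets_def UMet_def Met_def ext_metric_def ultrametric_def disc_def
  by (auto simp: max_def)

lemma FinDisc_subset:
  assumes "small_sets U" "K = Met U \<or> K = UMet U"
  shows "FinDisc \<subseteq> K"
  using assms finite_disc_in_UMet unfolding FinDisc_def UMet_def by blast

lemma Vsp_in_FinDisc: "Vsp x n \<in> FinDisc"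
  unfolding Vsp_def FinDisc_def by blast

lemma maps_from_disc_nex:
  assumes "ext_metric Y" "k \<in> A \<rightarrow>\<^sub>E pts Y"
  shows "k \<in> nex (disc A) Y"
proof -
  have "edst Y (k a) (k a) = 0" if "a \<in> A" for a
    using assms that unfolding ext_metric_def by (metis PiE_mem)
  then show ?thesis
    using assms(2) unfolding nex_def disc_def by auto
qed

lemma sym_tm_in_terms:
  assumes "\<sigma> \<in> pts (fob T (Vsp x n))"
  shows "sym_tm n \<sigma> \<in> terms (assoc_sig x T)"
  unfolding sym_tm_def
  by (rule terms.intros(2)) (use assms in \<open>auto simp: assoc_sig_def intro: terms.intros(1)\<close>)

lemma assoc_eqs_subset_quant_eqs:
  assumes U: "small_sets U" "K = Met U \<or> K = UMet U" and T: "enriched_monad K T"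
  shows "assoc_eqs x T \<subseteq> quant_eqs (assoc_sig x T)"
proof -
  let ?V = "Vsp x"
  have V: "?V n \<in> K" for n
    using FinDisc_subset[OF U] Vsp_in_FinDisc by blast
  have F: "enriched_functor K K T"
    using T unfolding enriched_monad_def by blast
  have TV: "fob T (?V n) \<in> K" for n
    using F V unfolding enriched_functor_def by blast
  have met: "ext_metric X" if "X \<in> K" for X
    using U(2) that unfolding UMet_def Met_def by auto
  have kl: "kl_ext x T n m k \<sigma> \<in> pts (fob T (?V m))"
    if "\<sigma> \<in> pts (fob T (?V n))" "k \<in> pts (?V n) \<rightarrow>\<^sub>E pts (fob T (?V m))" for n m k \<sigma>
  proof -
    have "k \<in> nex (?V n) (fob T (?V m))"
      using maps_from_disc_nex[OF met[OF TV]] that(2) unfolding Vsp_def disc_def by auto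
    then have "fmp T (?V n) (fob T (?V m)) k \<in> nex (fob T (?V n)) (fob T (fob T (?V m)))"
      using F V TV unfolding enriched_functor_def by blast
    moreover have "mu T (?V m) \<in> nex (fob T (fob T (?V m))) (fob T (?V m))"
      using T V unfolding enriched_monad_def by blast
    ultimately show ?thesis
      using that(1) unfolding kl_ext_def nex_def compose_def by (auto simp: PiE_iff)
  qed
  have eta: "eta T (?V n) (x i) \<in> pts (fob T (?V n))" if "i < n" for n i
  proof -
    have "eta T (?V n) \<in> nex (?V n) (fob T (?V n))"
      using T V unfolding enriched_monad_def by blast
    then show ?thesis
      using that unfolding nex_def Vsp_def disc_def by (auto simp: PiE_iff)
  qed
  have comp: "App (n, \<sigma>) (map (\<lambda>i. sym_tm m (k (x i))) [0..<n]) \<in> terms (assoc_sig x T)"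
    if "\<sigma> \<in> pts (fob T (?V n))" "k \<in> pts (?V n) \<rightarrow>\<^sub>E pts (fob T (?V m))" for n m k \<sigma>
  proof (rule terms.intros(2))
    show "(n, \<sigma>) \<in> syms (assoc_sig x T)"
      using that(1) unfolding assoc_sig_def by simp
    show "length (map (\<lambda>i. sym_tm m (k (x i))) [0..<n]) = arity (assoc_sig x T) (n, \<sigma>)"
      unfolding assoc_sig_def by simp
    fix t assume "t \<in> set (map (\<lambda>i. sym_tm m (k (x i))) [0..<n])"
    then obtain i where "i < n" "t = sym_tm m (k (x i))" by auto
    moreover from \<open>i < n\<close> have "k (x i) \<in> pts (fob T (?V m))"
      using that(2) unfolding Vsp_def disc_def by (auto simp: PiE_iff)
    ultimately show "t \<in> terms (assoc_sig x T)"
      using sym_tm_in_terms by metis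
  qed
  show ?thesis
    unfolding assoc_eqs_def quant_eqs_def
    by (auto intro!: sym_tm_in_terms[OF kl] sym_tm_in_terms[OF eta] comp
        intro: sym_tm_in_terms terms.intros(1))
qed

end

theory Submission
  imports Defs
begin

text \<open>
  The proof shows that \<open>T X\<close> is the free algebra on \<open>X\<close> in the associated variety. An element \<open>\<sigma>\<close> of
  \<open>T V\<^sub>n\<close> operates on \<open>T X\<close> by Kleisli extension: an \<open>n\<close>-tuple is a map \<open>a\<close> from the discrete space \<open>V\<^sub>n\<close> to
  \<open>T X\<close>, and the result is \<open>\<mu> (T a \<sigma>)\<close>. Since \<open>T\<close> is enriched, this is nonexpanding in \<open>a\<close>. The equations
  hold because Kleisli extensions are nonexpanding, associative and unital (\<open>falg_in_variety\<close>).

  Strong finitariness enters twice. First, it forces every element of \<open>T X\<close> to be of the form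
  \<open>T a \<sigma>\<close> with \<open>\<sigma>\<close> in some \<open>T V\<^sub>n\<close> (\<open>finite_support\<close>), because the union of the images of the maps \<open>T a\<close> is a
  subspace that already has the universal property of \<open>T X\<close>. As \<open>T a \<sigma>\<close> is the value of the
  operation \<open>\<sigma>\<close> at the tuple \<open>\<eta> \<circ> a\<close>, the algebra \<open>T X\<close> is generated by \<open>\<eta>\<close>, and homomorphic extensions
  are unique (\<open>hom_unique\<close>). Second, it provides the extensions: for an algebra \<open>A\<close> of the variety
  and a map \<open>f\<close> from \<open>X\<close> to \<open>A\<close>, the assignment of \<open>\<sigma>\<^sub>A (f \<circ> a)\<close> to \<open>a\<close> and \<open>\<sigma>\<close> is nonexpanding and natural by
  the equations, so it is induced by a nonexpanding map on \<open>T X\<close> (\<open>evaluation_map\<close>). That this map is a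
  homomorphism can be checked on finitely many elements at a time, and these live over a
  common finite discrete space (\<open>common_finite_support\<close>, \<open>hom_extension\<close>).

  Hence \<open>T\<close> itself is the monad of one free adjunction, and any two left adjoints of the same
  forgetful functor induce isomorphic monads (\<open>free_adjunctions_monad_iso\<close>).
\<close>


section \<open>Nonexpanding maps and homomorphisms\<close>

lemma nex_pt: "f \<in> nex X Y \<Longrightarrow> p \<in> pts X \<Longrightarrow> f p \<in> pts Y"
  unfolding nex_def by (auto simp: PiE_iff)

lemma nex_dst:
  "f \<in> nex X Y \<Longrightarrow> p \<in> pts X \<Longrightarrow> q \<in> pts X \<Longrightarrow> edst Y (f p) (f q) \<le> edst X p q"
  unfolding nex_def by auto

lemma nexI:
  assumes "f \<in> extensional (pts X)" "\<And>p. p \<in> pts X \<Longrightarrow> f p \<in> pts Y"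
    "\<And>p q. p \<in> pts X \<Longrightarrow> q \<in> pts X \<Longrightarrow> edst Y (f p) (f q) \<le> edst X p q"
  shows "f \<in> nex X Y"
  using assms unfolding nex_def by (auto simp: PiE_iff)

lemma nex_eqI:
  assumes "f \<in> nex X Y" "g \<in> nex X Z" "\<And>p. p \<in> pts X \<Longrightarrow> f p = g p"
  shows "f = g"
  by (rule extensionalityI[of _ "pts X"]) (use assms in \<open>auto simp: nex_def PiE_iff\<close>)

lemma nex_ident: "ident X \<in> nex X X"
  by (rule nexI) auto

lemma nex_compose:
  assumes "f \<in> nex X Y" "g \<in> nex Y Z"
  shows "compose (pts X) g f \<in> nex X Z"
proof (rule nexI)
  fix p q assume pq: "p \<in> pts X" "q \<in> pts X"
  have "edst Z (g (f p)) (g (f q)) \<le> edst Y (f p) (f q)"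
    using assms pq by (simp add: nex_dst nex_pt)
  also have "\<dots> \<le> edst X p q"
    using assms pq by (simp add: nex_dst)
  finally show "edst Z (compose (pts X) g f p) (compose (pts X) g f q) \<le> edst X p q"
    using pq by (simp add: compose_eq)
qed (use assms in \<open>auto simp: compose_eq intro: nex_pt\<close>)

lemma compose_cong_pt:
  assumes "\<And>p. p \<in> A \<Longrightarrow> g (f p) = g' (f' p)"
  shows "compose A g f = compose A g' f'"
  using assms by (auto simp: compose_def restrict_def)

lemma compose_eq_restrict:
  assumes "\<And>p. p \<in> A \<Longrightarrow> g (f p) = h p"
  shows "compose A g f = (\<lambda>p\<in>A. h p)"
  using assms by (auto simp: compose_def restrict_def)

lemma compose_eqD: "compose A g f = h \<Longrightarrow> p \<in> A \<Longrightarrow> g (f p) = h p"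
  by (auto simp: compose_eq)

lemma sup_dst_upper: "p \<in> pts X \<Longrightarrow> edst Y (f p) (g p) \<le> sup_dst X Y f g"
  unfolding sup_dst_def by (rule SUP_upper)

lemma sup_dst_least:
  "(\<And>p. p \<in> pts X \<Longrightarrow> edst Y (f p) (g p) \<le> d) \<Longrightarrow> sup_dst X Y f g \<le> d"
  unfolding sup_dst_def by (rule SUP_least)

lemma ext_metric_eqD:
  "ext_metric X \<Longrightarrow> p \<in> pts X \<Longrightarrow> q \<in> pts X \<Longrightarrow> edst X p q \<le> 0 \<Longrightarrow> p = q"
  unfolding ext_metric_def by auto

lemma alg_hom_nex: "h \<in> alg_hom \<Sigma> A B \<Longrightarrow> h \<in> nex (sp A) (sp B)"
  unfolding alg_hom_def by auto

lemma alg_hom_op: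
  "h \<in> alg_hom \<Sigma> A B \<Longrightarrow> s \<in> syms \<Sigma> \<Longrightarrow> as \<in> tuples (arity \<Sigma> s) (pts (sp A)) \<Longrightarrow>
   h (op_of A s as) = op_of B s (map h as)"
  unfolding alg_hom_def by auto

lemma quant_alg_op:
  "quant_alg K \<Sigma> A \<Longrightarrow> s \<in> syms \<Sigma> \<Longrightarrow> as \<in> tuples (arity \<Sigma> s) (pts (sp A)) \<Longrightarrow>
   op_of A s as \<in> pts (sp A)"
  unfolding quant_alg_def by auto

lemma quant_alg_sp: "quant_alg K \<Sigma> A \<Longrightarrow> sp A \<in> K"
  unfolding quant_alg_def by auto

lemma alg_hom_ident:
  assumes "quant_alg K \<Sigma> A"
  shows "ident (sp A) \<in> alg_hom \<Sigma> A A"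
proof -
  have "map (ident (sp A)) as = as" if "as \<in> tuples n (pts (sp A))" for n as
    using that by (intro map_idI) (auto simp: tuples_def)
  then show ?thesis
    using quant_alg_op[OF assms] unfolding alg_hom_def by (auto simp: nex_ident)
qed

lemma alg_hom_compose:
  assumes A: "quant_alg K \<Sigma> A" and f: "f \<in> alg_hom \<Sigma> A B" and g: "g \<in> alg_hom \<Sigma> B C"
  shows "compose (pts (sp A)) g f \<in> alg_hom \<Sigma> A C"
proof -
  let ?gf = "compose (pts (sp A)) g f"
  have "?gf (op_of A s as) = op_of C s (map ?gf as)"
    if s: "s \<in> syms \<Sigma>" and as: "as \<in> tuples (arity \<Sigma> s) (pts (sp A))" for s as
  proof -
    have "map f as \<in> tuples (arity \<Sigma> s) (pts (sp B))"
      using as nex_pt[OF alg_hom_nex[OF f]] by (auto simp: tuples_def)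
    then have "?gf (op_of A s as) = op_of C s (map g (map f as))"
      using quant_alg_op[OF A s as] alg_hom_op[OF f s as] alg_hom_op[OF g s]
      by (simp add: compose_eq)
    also have "map g (map f as) = map ?gf as"
      using as by (auto simp: tuples_def compose_eq)
    finally show ?thesis .
  qed
  then show ?thesis
    using nex_compose[OF alg_hom_nex[OF f] alg_hom_nex[OF g]] unfolding alg_hom_def by auto
qed


section \<open>Uniqueness of the free-algebra monad\<close>

locale free_algebras =
  fixes K :: "'u emetric set" and \<Sigma> :: "'s signature" and \<V> :: "('u, 's) qalg set"
    and F :: "('u, 's) free_adj"
  assumes alg: "A \<in> \<V> \<Longrightarrow> quant_alg K \<Sigma> A"
    and adj: "free_adjunction K \<Sigma> \<V> F"
begin

text \<open>
  The clauses of the definition, one at a time: \<open>law\<close> with number \<open>k\<close> is the conjunction of all clauses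
  from the \<open>k\<close>-th on. The laws of the monad and of its functor are split in the same way below.
\<close>

lemmas law1 = adj[unfolded free_adjunction_def]
lemmas law2 = law1[THEN conjunct2]
lemmas law3 = law2[THEN conjunct2]
lemmas law4 = law3[THEN conjunct2]
lemmas law5 = law4[THEN conjunct2]
lemmas law6 = law5[THEN conjunct2]
lemmas law7 = law6[THEN conjunct2]
lemmas law8 = law7[THEN conjunct2]
lemmas law9 = law8[THEN conjunct2]
lemmas law10 = law9[THEN conjunct2]
lemmas law11 = law10[THEN conjunct2]

lemma free_in_variety: "X \<in> K \<Longrightarrow> free_ob F X \<in> \<V>"
  using law1[THEN conjunct1] by blast

lemma sp_in_base: "A \<in> \<V> \<Longrightarrow> sp A \<in> K"
  using alg quant_alg_sp by blast

lemma free_space_in_base: "X \<in> K \<Longrightarrow> sp (free_ob F X) \<in> K"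
  using free_in_variety sp_in_base by blast

lemma free_mp_hom:
  "X \<in> K \<Longrightarrow> Y \<in> K \<Longrightarrow> f \<in> nex X Y \<Longrightarrow>
   free_mp F X Y f \<in> alg_hom \<Sigma> (free_ob F X) (free_ob F Y)"
  using law2[THEN conjunct1] by blast

lemma free_mp_comp:
  assumes "X \<in> K" "Y \<in> K" "Z \<in> K" "f \<in> nex X Y" "g \<in> nex Y Z" "t \<in> pts (sp (free_ob F X))"
  shows "free_mp F Y Z g (free_mp F X Y f t) = free_mp F X Z (compose (pts X) g f) t"
proof -
  have "free_mp F X Z (compose (pts X) g f) =
      compose (pts (sp (free_ob F X))) (free_mp F Y Z g) (free_mp F X Y f)"
    using law4[THEN conjunct1] assms by blast
  then show ?thesis
    using assms(6) by (simp add: compose_eq)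
qed

lemma unit_nex: "X \<in> K \<Longrightarrow> adj_unit F X \<in> nex X (sp (free_ob F X))"
  using law6[THEN conjunct1] by blast

lemma unit_pt: "X \<in> K \<Longrightarrow> p \<in> pts X \<Longrightarrow> adj_unit F X p \<in> pts (sp (free_ob F X))"
  by (rule nex_pt[OF unit_nex])

lemma unit_natural:
  assumes "X \<in> K" "Y \<in> K" "f \<in> nex X Y" "p \<in> pts X"
  shows "free_mp F X Y f (adj_unit F X p) = adj_unit F Y (f p)"
proof -
  have "compose (pts X) (adj_unit F Y) f = compose (pts X) (free_mp F X Y f) (adj_unit F X)"
    using law7[THEN conjunct1] assms by blast
  from fun_cong[OF this, of p] show ?thesis
    using assms(4) by (simp add: compose_eq)
qed

lemma counit_hom: "A \<in> \<V> \<Longrightarrow> adj_counit F A \<in> alg_hom \<Sigma> (free_ob F (sp A)) A"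
  using law8[THEN conjunct1] by blast

lemma counit_natural:
  assumes "A \<in> \<V>" "B \<in> \<V>" "h \<in> alg_hom \<Sigma> A B" "t \<in> pts (sp (free_ob F (sp A)))"
  shows "adj_counit F B (free_mp F (sp A) (sp B) h t) = h (adj_counit F A t)"
proof -
  have "compose (pts (sp (free_ob F (sp A)))) (adj_counit F B) (free_mp F (sp A) (sp B) h) =
        compose (pts (sp (free_ob F (sp A)))) h (adj_counit F A)"
    using law9[THEN conjunct1] assms by blast
  from fun_cong[OF this, of t] show ?thesis
    using assms(4) by (simp add: compose_eq)
qed

lemma triangle_free:
  assumes "X \<in> K" "t \<in> pts (sp (free_ob F X))"
  shows "adj_counit F (free_ob F X) (free_mp F X (sp (free_ob F X)) (adj_unit F X) t) = t"
proof -
  have "compose (pts (sp (free_ob F X))) (adj_counit F (free_ob F X))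
          (free_mp F X (sp (free_ob F X)) (adj_unit F X)) = ident (sp (free_ob F X))"
    using law10[THEN conjunct1] assms by blast
  from compose_eqD[OF this assms(2)] show ?thesis
    using assms(2) by simp
qed

lemma triangle_forgetful:
  assumes "A \<in> \<V>" "p \<in> pts (sp A)"
  shows "adj_counit F A (adj_unit F (sp A) p) = p"
proof -
  have "compose (pts (sp A)) (adj_counit F A) (adj_unit F (sp A)) = ident (sp A)"
    using law11 assms by blast
  from compose_eqD[OF this assms(2)] show ?thesis
    using assms(2) by simp
qed

lemma extension_exists:
  assumes X: "X \<in> K" and A: "A \<in> \<V>" and f: "f \<in> nex X (sp A)"
  shows "\<exists>h\<in>alg_hom \<Sigma> (free_ob F X) A. \<forall>p\<in>pts X. h (adj_unit F X p) = f p"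
proof
  note K = X sp_in_base[OF A]
  let ?h = "compose (pts (sp (free_ob F X))) (adj_counit F A) (free_mp F X (sp A) f)"
  show "?h \<in> alg_hom \<Sigma> (free_ob F X) A"
    by (rule alg_hom_compose[OF alg[OF free_in_variety[OF X]] free_mp_hom[OF K f] counit_hom[OF A]])
  show "\<forall>p\<in>pts X. ?h (adj_unit F X p) = f p"
    using K A f by (simp add: compose_eq unit_pt unit_natural triangle_forgetful nex_pt)
qed

text \<open>
  By naturality of the counit and the triangle law, a homomorphism \<open>h\<close> out of the free algebra
  equals the counit after the free map on \<open>h \<circ> \<eta>\<close>, so \<open>h\<close> is recovered from its values on generators.
\<close>

lemma extension_unique:
  assumes X: "X \<in> K" and A: "A \<in> \<V>"
    and h: "h \<in> alg_hom \<Sigma> (free_ob F X) A" and h': "h' \<in> alg_hom \<Sigma> (free_ob F X) A"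
    and eq: "\<And>p. p \<in> pts X \<Longrightarrow> h (adj_unit F X p) = h' (adj_unit F X p)"
  shows "h = h'"
proof (rule nex_eqI[OF alg_hom_nex[OF h] alg_hom_nex[OF h']])
  fix t assume t: "t \<in> pts (sp (free_ob F X))"
  let ?FX = "free_ob F X"
  note K = X free_space_in_base[OF X] sp_in_base[OF A]
  have via_unit: "g t = adj_counit F A (free_mp F X (sp A) (compose (pts X) g (adj_unit F X)) t)"
    if g: "g \<in> alg_hom \<Sigma> ?FX A" for g
  proof -
    let ?s = "free_mp F X (sp ?FX) (adj_unit F X) t"
    have s: "?s \<in> pts (sp (free_ob F (sp ?FX)))"
      using nex_pt[OF alg_hom_nex[OF free_mp_hom[OF K(1,2) unit_nex[OF X]]] t] .
    have "g t = g (adj_counit F ?FX ?s)"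
      using triangle_free[OF X t] by simp
    also have "\<dots> = adj_counit F A (free_mp F (sp ?FX) (sp A) g ?s)"
      using counit_natural[OF free_in_variety[OF X] A g s] by simp
    also have "\<dots> = adj_counit F A (free_mp F X (sp A) (compose (pts X) g (adj_unit F X)) t)"
      using free_mp_comp[OF K unit_nex[OF X] alg_hom_nex[OF g] t] by simp
    finally show ?thesis .
  qed
  have "compose (pts X) h (adj_unit F X) = compose (pts X) h' (adj_unit F X)"
    by (rule compose_cong_pt) (rule eq)
  then show "h t = h' t"
    using via_unit[OF h] via_unit[OF h'] by simp
qed

end

text \<open>
  Two left adjoints of one forgetful functor have the same universal property. The comparison
  \<open>\<phi>\<close> extends the unit of \<open>G\<close> along the unit of \<open>F\<close>; each equation required of it holds because both
  sides are homomorphisms out of a free algebra that agree on generators.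
\<close>

lemma free_adjunctions_monad_iso:
  assumes alg: "\<And>A. A \<in> \<V> \<Longrightarrow> quant_alg K \<Sigma> A"
    and F: "free_adjunction K \<Sigma> \<V> F" and G: "free_adjunction K \<Sigma> \<V> G"
  shows "monad_iso K (adj_monad F) (adj_monad G)"
proof -
  interpret F: free_algebras K \<Sigma> \<V> F by unfold_locales (use alg F in auto)
  interpret G: free_algebras K \<Sigma> \<V> G by unfold_locales (use alg G in auto)
  note FV = F.free_in_variety and GV = G.free_in_variety
  have "\<forall>X\<in>K. \<exists>h\<in>alg_hom \<Sigma> (free_ob F X) (free_ob G X).
      \<forall>p\<in>pts X. h (adj_unit F X p) = adj_unit G X p"
    using F.extension_exists[OF _ GV G.unit_nex] by simp
  then obtain \<phi> where \<phi>: "\<And>X. X \<in> K \<Longrightarrow> \<phi> X \<in> alg_hom \<Sigma> (free_ob F X) (free_ob G X)"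
    and \<phi>_unit: "\<And>X p. X \<in> K \<Longrightarrow> p \<in> pts X \<Longrightarrow> \<phi> X (adj_unit F X p) = adj_unit G X p"
    by metis
  have "\<forall>X\<in>K. \<exists>h\<in>alg_hom \<Sigma> (free_ob G X) (free_ob F X).
      \<forall>p\<in>pts X. h (adj_unit G X p) = adj_unit F X p"
    using G.extension_exists[OF _ FV F.unit_nex] by simp
  then obtain \<psi> where \<psi>: "\<And>X. X \<in> K \<Longrightarrow> \<psi> X \<in> alg_hom \<Sigma> (free_ob G X) (free_ob F X)"
    and \<psi>_unit: "\<And>X p. X \<in> K \<Longrightarrow> p \<in> pts X \<Longrightarrow> \<psi> X (adj_unit G X p) = adj_unit F X p"
    by metis
  have \<psi>\<phi>: "compose (pts (sp (free_ob F X))) (\<psi> X) (\<phi> X) = ident (sp (free_ob F X))"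
    if X: "X \<in> K" for X
    by (rule F.extension_unique[OF X FV[OF X] alg_hom_compose[OF alg[OF FV[OF X]] \<phi>[OF X] \<psi>[OF X]]
          alg_hom_ident[OF alg[OF FV[OF X]]]])
      (simp add: compose_eq X F.unit_pt \<phi>_unit \<psi>_unit)
  have \<phi>\<psi>: "compose (pts (sp (free_ob G X))) (\<phi> X) (\<psi> X) = ident (sp (free_ob G X))"
    if X: "X \<in> K" for X
    by (rule G.extension_unique[OF X GV[OF X] alg_hom_compose[OF alg[OF GV[OF X]] \<psi>[OF X] \<phi>[OF X]]
          alg_hom_ident[OF alg[OF GV[OF X]]]])
      (simp add: compose_eq X G.unit_pt \<phi>_unit \<psi>_unit)
  have natural: "compose (pts (sp (free_ob F X))) (\<phi> Y) (free_mp F X Y f) =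
      compose (pts (sp (free_ob F X))) (free_mp G X Y f) (\<phi> X)"
    if X: "X \<in> K" and Y: "Y \<in> K" and f: "f \<in> nex X Y" for X Y f
    by (rule F.extension_unique[OF X GV[OF Y]
          alg_hom_compose[OF alg[OF FV[OF X]] F.free_mp_hom[OF X Y f] \<phi>[OF Y]]
          alg_hom_compose[OF alg[OF FV[OF X]] \<phi>[OF X] G.free_mp_hom[OF X Y f]]])
      (simp add: compose_eq X Y f F.unit_pt F.unit_natural G.unit_natural \<phi>_unit nex_pt[OF f])
  have mult: "compose (pts (sp (free_ob F (sp (free_ob F X))))) (\<phi> X) (adj_counit F (free_ob F X)) =
      compose (pts (sp (free_ob F (sp (free_ob F X))))) (adj_counit G (free_ob G X))
        (compose (pts (sp (free_ob F (sp (free_ob F X)))))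
          (free_mp G (sp (free_ob F X)) (sp (free_ob G X)) (\<phi> X)) (\<phi> (sp (free_ob F X))))"
    if X: "X \<in> K" for X
  proof -
    let ?FX = "sp (free_ob F X)" and ?GX = "sp (free_ob G X)"
    note FX = F.free_space_in_base[OF X] and GX = G.free_space_in_base[OF X]
    note \<phi>X = alg_hom_nex[OF \<phi>[OF X]]
    show ?thesis
      by (rule F.extension_unique[OF FX GV[OF X]
            alg_hom_compose[OF alg[OF FV[OF FX]] F.counit_hom[OF FV[OF X]] \<phi>[OF X]]
            alg_hom_compose[OF alg[OF FV[OF FX]]
              alg_hom_compose[OF alg[OF FV[OF FX]] \<phi>[OF FX] G.free_mp_hom[OF FX GX \<phi>X]]
              G.counit_hom[OF GV[OF X]]]])
        (simp add: compose_eq X FX GX F.unit_pt F.triangle_forgetful[OF FV[OF X]] \<phi>_unit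
          G.unit_natural[OF FX GX \<phi>X] G.triangle_forgetful[OF GV[OF X]] nex_pt[OF \<phi>X])
  qed
  have unit: "compose (pts X) (\<phi> X) (adj_unit F X) = adj_unit G X" if X: "X \<in> K" for X
    by (rule nex_eqI[OF nex_compose[OF F.unit_nex[OF X] alg_hom_nex[OF \<phi>[OF X]]] G.unit_nex[OF X]])
      (simp add: compose_eq \<phi>_unit X)
  show ?thesis
    unfolding monad_iso_def adj_monad_def
    by (rule exI[of _ \<phi>], rule exI[of _ \<psi>])
      (simp add: alg_hom_nex[OF \<phi>] alg_hom_nex[OF \<psi>] \<psi>\<phi> \<phi>\<psi> natural mult unit)
qed


section \<open>Strongly finitary monads\<close>

definition subsp :: "'u emetric \<Rightarrow> 'u set \<Rightarrow> 'u emetric" where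
  "subsp X Z = \<lparr>pts = Z, edst = (\<lambda>p q. if p \<in> Z \<and> q \<in> Z then edst X p q else 0)\<rparr>"

lemma subsp_simps [simp]:
  "pts (subsp X Z) = Z"
  "p \<in> Z \<Longrightarrow> q \<in> Z \<Longrightarrow> edst (subsp X Z) p q = edst X p q"
  by (auto simp: subsp_def)

lemma subspace_in_base:
  assumes "small_sets U" "K = Met U \<or> K = UMet U" "X \<in> K" "Z \<subseteq> pts X"
  shows "subsp X Z \<in> K"
proof -
  have "X \<in> Met U"
    using assms(2,3) unfolding UMet_def by auto
  then have "subsp X Z \<in> Met U"
    using assms(1,4) unfolding Met_def small_sets_def ext_metric_def subsp_def
    by (auto simp: subset_iff)
  moreover have "ultrametric (subsp X Z)" if "ultrametric X"
    using that assms(4) unfolding ultrametric_def subsp_def by (auto simp: subset_iff)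
  ultimately show ?thesis
    using assms(2,3) unfolding UMet_def by auto
qed

text \<open>
  \<open>Met\<close> and \<open>UMet\<close> are treated uniformly: what matters about the base category is that it contains
  the finite discrete spaces and is closed under subspaces.
\<close>

locale strongly_finitary_monad =
  fixes K :: "'u emetric set" and T :: "'u emonad" and x :: "nat \<Rightarrow> 'u"
  assumes fin_disc: "FinDisc \<subseteq> K"
    and metric: "X \<in> K \<Longrightarrow> ext_metric X"
    and subspace: "X \<in> K \<Longrightarrow> Z \<subseteq> pts X \<Longrightarrow> subsp X Z \<in> K"
    and inj_x: "inj x"
    and monad: "enriched_monad K T"
    and fin: "strongly_finitary K T"
begin

abbreviation V :: "nat \<Rightarrow> 'u emetric" where "V \<equiv> Vsp x"
abbreviation T\<^sub>0 :: "'u emetric \<Rightarrow> 'u emetric" where "T\<^sub>0 \<equiv> fob T"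
abbreviation T\<^sub>1 :: "'u emetric \<Rightarrow> 'u emetric \<Rightarrow> ('u \<Rightarrow> 'u) \<Rightarrow> 'u \<Rightarrow> 'u" where "T\<^sub>1 \<equiv> fmp T"

lemmas monad_law1 = monad[unfolded enriched_monad_def]
lemmas monad_law2 = monad_law1[THEN conjunct2]
lemmas monad_law3 = monad_law2[THEN conjunct2]
lemmas monad_law4 = monad_law3[THEN conjunct2]
lemmas monad_law5 = monad_law4[THEN conjunct2]
lemmas monad_law6 = monad_law5[THEN conjunct2]
lemmas monad_law7 = monad_law6[THEN conjunct2]
lemmas monad_law8 = monad_law7[THEN conjunct2]

lemma T_functor: "enriched_functor K K T"
  using monad_law1[THEN conjunct1] by blast

lemmas functor_law1 = T_functor[unfolded enriched_functor_def]
lemmas functor_law2 = functor_law1[THEN conjunct2]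
lemmas functor_law3 = functor_law2[THEN conjunct2]
lemmas functor_law4 = functor_law3[THEN conjunct2]
lemmas functor_law5 = functor_law4[THEN conjunct2]

lemma V_in [simp]: "V n \<in> K"
  using fin_disc Vsp_in_FinDisc by blast

lemma T_in [simp]: "X \<in> K \<Longrightarrow> T\<^sub>0 X \<in> K"
  using functor_law1[THEN conjunct1] by blast

lemma T_nex: "X \<in> K \<Longrightarrow> Y \<in> K \<Longrightarrow> f \<in> nex X Y \<Longrightarrow> T\<^sub>1 X Y f \<in> nex (T\<^sub>0 X) (T\<^sub>0 Y)"
  using functor_law2[THEN conjunct1] by blast

lemma T_pt:
  "X \<in> K \<Longrightarrow> Y \<in> K \<Longrightarrow> f \<in> nex X Y \<Longrightarrow> t \<in> pts (T\<^sub>0 X) \<Longrightarrow> T\<^sub>1 X Y f t \<in> pts (T\<^sub>0 Y)"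
  by (rule nex_pt[OF T_nex])

lemma T_comp:
  assumes "X \<in> K" "Y \<in> K" "Z \<in> K" "f \<in> nex X Y" "g \<in> nex Y Z" "t \<in> pts (T\<^sub>0 X)"
  shows "T\<^sub>1 Y Z g (T\<^sub>1 X Y f t) = T\<^sub>1 X Z (compose (pts X) g f) t"
proof -
  have "T\<^sub>1 X Z (compose (pts X) g f) = compose (pts (T\<^sub>0 X)) (T\<^sub>1 Y Z g) (T\<^sub>1 X Y f)"
    using functor_law4[THEN conjunct1] assms by blast
  then show ?thesis
    using assms(6) by (simp add: compose_eq)
qed

lemma T_enriched:
  assumes "X \<in> K" "Y \<in> K" "f \<in> nex X Y" "g \<in> nex X Y" "t \<in> pts (T\<^sub>0 X)"
  shows "edst (T\<^sub>0 Y) (T\<^sub>1 X Y f t) (T\<^sub>1 X Y g t) \<le> sup_dst X Y f g"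
proof -
  have "sup_dst (T\<^sub>0 X) (T\<^sub>0 Y) (T\<^sub>1 X Y f) (T\<^sub>1 X Y g) \<le> sup_dst X Y f g"
    using functor_law5 assms by blast
  then show ?thesis
    using sup_dst_upper[OF assms(5)] order_trans by blast
qed

lemma eta_nex: "X \<in> K \<Longrightarrow> eta T X \<in> nex X (T\<^sub>0 X)"
  using monad_law2[THEN conjunct1] by blast

lemma eta_pt: "X \<in> K \<Longrightarrow> p \<in> pts X \<Longrightarrow> eta T X p \<in> pts (T\<^sub>0 X)"
  by (rule nex_pt[OF eta_nex])

lemma mu_nex: "X \<in> K \<Longrightarrow> mu T X \<in> nex (T\<^sub>0 (T\<^sub>0 X)) (T\<^sub>0 X)"
  using monad_law3[THEN conjunct1] by blast

lemma eta_natural: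
  assumes "X \<in> K" "Y \<in> K" "f \<in> nex X Y" "p \<in> pts X"
  shows "T\<^sub>1 X Y f (eta T X p) = eta T Y (f p)"
proof -
  have "compose (pts X) (eta T Y) f = compose (pts X) (T\<^sub>1 X Y f) (eta T X)"
    using monad_law4[THEN conjunct1] assms by blast
  from fun_cong[OF this, of p] show ?thesis
    using assms(4) by (simp add: compose_eq)
qed

lemma mu_natural:
  assumes "X \<in> K" "Y \<in> K" "f \<in> nex X Y" "t \<in> pts (T\<^sub>0 (T\<^sub>0 X))"
  shows "T\<^sub>1 X Y f (mu T X t) = mu T Y (T\<^sub>1 (T\<^sub>0 X) (T\<^sub>0 Y) (T\<^sub>1 X Y f) t)"
proof -
  have "compose (pts (T\<^sub>0 (T\<^sub>0 X))) (mu T Y) (T\<^sub>1 (T\<^sub>0 X) (T\<^sub>0 Y) (T\<^sub>1 X Y f)) =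
        compose (pts (T\<^sub>0 (T\<^sub>0 X))) (T\<^sub>1 X Y f) (mu T X)"
    using monad_law5[THEN conjunct1] assms by blast
  from fun_cong[OF this, of t] show ?thesis
    using assms(4) by (simp add: compose_eq)
qed

lemma mu_eta:
  assumes "X \<in> K" "t \<in> pts (T\<^sub>0 X)"
  shows "mu T X (eta T (T\<^sub>0 X) t) = t"
proof -
  have "compose (pts (T\<^sub>0 X)) (mu T X) (eta T (T\<^sub>0 X)) = ident (T\<^sub>0 X)"
    using monad_law6[THEN conjunct1] assms by blast
  from compose_eqD[OF this assms(2)] show ?thesis
    using assms(2) by simp
qed

lemma mu_T_eta:
  assumes "X \<in> K" "t \<in> pts (T\<^sub>0 X)"
  shows "mu T X (T\<^sub>1 X (T\<^sub>0 X) (eta T X) t) = t"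
proof -
  have "compose (pts (T\<^sub>0 X)) (mu T X) (T\<^sub>1 X (T\<^sub>0 X) (eta T X)) = ident (T\<^sub>0 X)"
    using monad_law7[THEN conjunct1] assms by blast
  from compose_eqD[OF this assms(2)] show ?thesis
    using assms(2) by simp
qed

lemma mu_mu:
  assumes "X \<in> K" "t \<in> pts (T\<^sub>0 (T\<^sub>0 (T\<^sub>0 X)))"
  shows "mu T X (mu T (T\<^sub>0 X) t) = mu T X (T\<^sub>1 (T\<^sub>0 (T\<^sub>0 X)) (T\<^sub>0 X) (mu T X) t)"
proof -
  have "compose (pts (T\<^sub>0 (T\<^sub>0 (T\<^sub>0 X)))) (mu T X) (mu T (T\<^sub>0 X)) =
        compose (pts (T\<^sub>0 (T\<^sub>0 (T\<^sub>0 X)))) (mu T X) (T\<^sub>1 (T\<^sub>0 (T\<^sub>0 X)) (T\<^sub>0 X) (mu T X))"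
    using monad_law8 assms by blast
  from fun_cong[OF this, of t] show ?thesis
    using assms(2) by (simp add: compose_eq)
qed


subsection \<open>Kleisli extension\<close>

definition bind :: "'u emetric \<Rightarrow> 'u emetric \<Rightarrow> ('u \<Rightarrow> 'u) \<Rightarrow> 'u \<Rightarrow> 'u" where
  "bind X Y k t = mu T Y (T\<^sub>1 X (T\<^sub>0 Y) k t)"

lemma bind_pt:
  "X \<in> K \<Longrightarrow> Y \<in> K \<Longrightarrow> k \<in> nex X (T\<^sub>0 Y) \<Longrightarrow> t \<in> pts (T\<^sub>0 X) \<Longrightarrow> bind X Y k t \<in> pts (T\<^sub>0 Y)"
  unfolding bind_def by (simp add: T_pt nex_pt[OF mu_nex])

lemma bind_dst:
  assumes "X \<in> K" "Y \<in> K" "k \<in> nex X (T\<^sub>0 Y)" "s \<in> pts (T\<^sub>0 X)" "t \<in> pts (T\<^sub>0 X)"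
  shows "edst (T\<^sub>0 Y) (bind X Y k s) (bind X Y k t) \<le> edst (T\<^sub>0 X) s t"
proof -
  have "compose (pts (T\<^sub>0 X)) (mu T Y) (T\<^sub>1 X (T\<^sub>0 Y) k) \<in> nex (T\<^sub>0 X) (T\<^sub>0 Y)"
    using assms by (auto intro!: nex_compose T_nex mu_nex)
  from nex_dst[OF this assms(4,5)] show ?thesis
    using assms(4,5) by (simp add: compose_eq bind_def)
qed

lemma bind_enriched:
  assumes "X \<in> K" "Y \<in> K" "k \<in> nex X (T\<^sub>0 Y)" "l \<in> nex X (T\<^sub>0 Y)" "t \<in> pts (T\<^sub>0 X)"
  shows "edst (T\<^sub>0 Y) (bind X Y k t) (bind X Y l t) \<le> sup_dst X (T\<^sub>0 Y) k l"
proof -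
  have "edst (T\<^sub>0 Y) (bind X Y k t) (bind X Y l t)
      \<le> edst (T\<^sub>0 (T\<^sub>0 Y)) (T\<^sub>1 X (T\<^sub>0 Y) k t) (T\<^sub>1 X (T\<^sub>0 Y) l t)"
    unfolding bind_def using assms by (simp add: nex_dst[OF mu_nex] T_pt)
  also have "\<dots> \<le> sup_dst X (T\<^sub>0 Y) k l"
    using assms by (simp add: T_enriched)
  finally show ?thesis .
qed

lemma bind_eta:
  assumes "X \<in> K" "Y \<in> K" "k \<in> nex X (T\<^sub>0 Y)" "p \<in> pts X"
  shows "bind X Y k (eta T X p) = k p"
  using assms unfolding bind_def by (simp add: eta_natural mu_eta nex_pt)

text \<open>
  Absorbing \<open>T f\<close> and \<open>\<mu>\<close> into a preceding Kleisli extension amounts to saying that they commute with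
  the operations on the spaces \<open>T X\<close>, which are Kleisli extensions.
\<close>

lemma T_bind:
  assumes "X \<in> K" "Y \<in> K" "Z \<in> K" "k \<in> nex X (T\<^sub>0 Y)" "f \<in> nex Y Z" "t \<in> pts (T\<^sub>0 X)"
  shows "T\<^sub>1 Y Z f (bind X Y k t) = bind X Z (compose (pts X) (T\<^sub>1 Y Z f) k) t"
  using assms unfolding bind_def by (simp add: mu_natural T_pt T_comp T_nex)

lemma T_as_bind:
  assumes "X \<in> K" "Y \<in> K" "f \<in> nex X Y" "t \<in> pts (T\<^sub>0 X)"
  shows "T\<^sub>1 X Y f t = bind X Y (compose (pts X) (eta T Y) f) t"
  using assms unfolding bind_def by (simp add: T_comp[symmetric, where Y=Y] eta_nex mu_T_eta T_pt)

lemma mu_bind: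
  assumes "X \<in> K" "Y \<in> K" "k \<in> nex X (T\<^sub>0 (T\<^sub>0 Y))" "t \<in> pts (T\<^sub>0 X)"
  shows "mu T Y (bind X (T\<^sub>0 Y) k t) = bind X Y (compose (pts X) (mu T Y) k) t"
  using assms unfolding bind_def by (simp add: mu_mu T_pt T_comp mu_nex)

lemma bind_bind:
  assumes "X \<in> K" "Y \<in> K" "Z \<in> K" "k \<in> nex X (T\<^sub>0 Y)" "l \<in> nex Y (T\<^sub>0 Z)" "t \<in> pts (T\<^sub>0 X)"
  shows "bind Y Z l (bind X Y k t) = bind X Z (compose (pts X) (bind Y Z l) k) t"
proof -
  have "bind Y Z l (bind X Y k t) =
      mu T Z (bind X (T\<^sub>0 Z) (compose (pts X) (T\<^sub>1 Y (T\<^sub>0 Z) l) k) t)"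
    using assms by (simp add: bind_def[of Y Z] T_bind)
  also have "\<dots> = bind X Z (compose (pts X) (mu T Z) (compose (pts X) (T\<^sub>1 Y (T\<^sub>0 Z) l) k)) t"
    using assms by (intro mu_bind nex_compose) (auto intro: T_nex)
  also have "compose (pts X) (mu T Z) (compose (pts X) (T\<^sub>1 Y (T\<^sub>0 Z) l) k) =
      compose (pts X) (bind Y Z l) k"
    by (rule compose_cong_pt) (simp add: compose_eq bind_def)
  finally show ?thesis .
qed


subsection \<open>Maps out of finite discrete spaces\<close>

text \<open>
  Operations take tuples and \<open>T\<close> acts on maps out of \<open>V n\<close>; \<open>vmap\<close> translates the former to the latter.
\<close>

definition vmap :: "nat \<Rightarrow> (nat \<Rightarrow> 'u) \<Rightarrow> 'u \<Rightarrow> 'u" where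
  "vmap n c = (\<lambda>v\<in>pts (V n). c (inv x v))"

lemma pts_V: "pts (V n) = x ` {..<n}"
  by (simp add: Vsp_def disc_def)

lemma vmap_x [simp]: "i < n \<Longrightarrow> vmap n c (x i) = c i"
  by (simp add: vmap_def pts_V inj_x)

lemma vmap_nex: "Y \<in> K \<Longrightarrow> (\<And>i. i < n \<Longrightarrow> c i \<in> pts Y) \<Longrightarrow> vmap n c \<in> nex (V n) Y"
  unfolding Vsp_def using inj_x
  by (intro maps_from_disc_nex metric) (auto simp: vmap_def pts_V)

lemma vmap_cong: "(\<And>i. i < n \<Longrightarrow> c i = d i) \<Longrightarrow> vmap n c = vmap n d"
  by (auto simp: vmap_def pts_V inj_x intro!: restrict_ext)

lemma compose_vmap: "compose (pts (V n)) g (vmap n c) = vmap n (\<lambda>i. g (c i))"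
  by (auto simp: vmap_def compose_def pts_V intro!: restrict_ext)

lemma vmap_ext: "a \<in> extensional (pts (V n)) \<Longrightarrow> vmap n (\<lambda>i. a (x i)) = a"
  by (rule extensionalityI[of _ "pts (V n)"]) (auto simp: pts_V vmap_def inj_x)

lemma sup_dst_vmap: "sup_dst (V n) Y (vmap n c) (vmap n d) = (SUP i\<in>{..<n}. edst Y (c i) (d i))"
  unfolding sup_dst_def pts_V by (simp add: image_image)

text \<open>
  Presheaves live on all finite discrete spaces, symbols only on the spaces \<open>V n\<close>. To pass between them,
  every \<open>D\<close> is presented as a retract of a \<open>V n\<close>: \<open>coord D\<close> followed by \<open>enum D\<close> is the identity of \<open>D\<close>.
\<close>

definition npts :: "'u emetric \<Rightarrow> nat" where
  "npts D = card (pts D)"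

definition enum :: "'u emetric \<Rightarrow> nat \<Rightarrow> 'u" where
  "enum D = (SOME h. bij_betw h {0..<npts D} (pts D))"

definition rank :: "'u emetric \<Rightarrow> 'u \<Rightarrow> nat" where
  "rank D = inv_into {0..<npts D} (enum D)"

definition coord :: "'u emetric \<Rightarrow> 'u \<Rightarrow> 'u" where
  "coord D = (\<lambda>d\<in>pts D. x (rank D d))"

lemma FinDisc_in [simp]: "D \<in> FinDisc \<Longrightarrow> D \<in> K"
  using fin_disc by blast

lemma enum_bij: "D \<in> FinDisc \<Longrightarrow> bij_betw (enum D) {0..<npts D} (pts D)"
  unfolding enum_def npts_def
  by (rule someI_ex[OF ex_bij_betw_nat_finite]) (auto simp: FinDisc_def disc_def)

lemma enum_pt: "D \<in> FinDisc \<Longrightarrow> i < npts D \<Longrightarrow> enum D i \<in> pts D"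
  using enum_bij[of D] by (auto simp: bij_betw_def)

lemma rank_less: "D \<in> FinDisc \<Longrightarrow> d \<in> pts D \<Longrightarrow> rank D d < npts D"
  using enum_bij[of D] inv_into_into[of d "enum D" "{0..<npts D}"]
  by (auto simp: bij_betw_def rank_def)

lemma enum_rank: "D \<in> FinDisc \<Longrightarrow> d \<in> pts D \<Longrightarrow> enum D (rank D d) = d"
  using enum_bij[of D] by (auto simp: bij_betw_def rank_def f_inv_into_f)

lemma nex_FinDisc:
  assumes "D \<in> FinDisc" "Y \<in> K" "f \<in> pts D \<rightarrow>\<^sub>E pts Y"
  shows "f \<in> nex D Y"
  using assms maps_from_disc_nex[OF metric[OF assms(2)]] unfolding FinDisc_def disc_def by auto

lemma coord_nex: "D \<in> FinDisc \<Longrightarrow> coord D \<in> nex D (V (npts D))"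
  by (rule nex_FinDisc) (auto simp: coord_def pts_V rank_less)

lemma enum_nex: "D \<in> FinDisc \<Longrightarrow> vmap (npts D) (enum D) \<in> nex (V (npts D)) D"
  by (rule vmap_nex) (auto simp: enum_pt)

lemma T_coord_pt: "D \<in> FinDisc \<Longrightarrow> s \<in> pts (T\<^sub>0 D) \<Longrightarrow> T\<^sub>1 D (V (npts D)) (coord D) s \<in> pts (T\<^sub>0 (V (npts D)))"
  by (rule T_pt) (auto simp: coord_nex)

lemma T_enum_coord:
  assumes D: "D \<in> FinDisc" and X: "X \<in> K" and a: "a \<in> nex D X" and s: "s \<in> pts (T\<^sub>0 D)"
  shows "T\<^sub>1 (V (npts D)) X (vmap (npts D) (\<lambda>i. a (enum D i))) (T\<^sub>1 D (V (npts D)) (coord D) s) =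
    T\<^sub>1 D X a s"
proof -
  let ?v = "vmap (npts D) (\<lambda>i. a (enum D i))"
  have v: "?v \<in> nex (V (npts D)) X"
    using assms by (intro vmap_nex) (auto intro: nex_pt enum_pt)
  have "compose (pts D) ?v (coord D) = a"
    by (rule nex_eqI[OF nex_compose[OF coord_nex[OF D] v] a])
      (simp add: compose_eq coord_def D rank_less enum_rank)
  then show ?thesis
    using T_comp[OF _ _ X coord_nex[OF D] v s] D by simp
qed


subsection \<open>The presheaf description of maps out of a value of the functor\<close>

lemma lan_comparison_pt:
  assumes "D \<in> FinDisc" "a \<in> nex D X" "s \<in> pts (T\<^sub>0 D)"
  shows "lan_comparison T T (\<lambda>D. ident (T\<^sub>0 D)) X h D a s = h (T\<^sub>1 D X a s)"
  using assms by (simp add: lan_comparison_def compose_eq)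

lemma comparison_bij:
  "X \<in> K \<Longrightarrow> Y \<in> K \<Longrightarrow>
   bij_betw (lan_comparison T T (\<lambda>D. ident (T\<^sub>0 D)) X) (nex (T\<^sub>0 X) Y) (presheaf_nat T X Y)"
  using fin unfolding strongly_finitary_def enriched_Lan_def by blast

lemma presheaf_nat_induces_map:
  assumes X: "X \<in> K" and Y: "Y \<in> K" and \<alpha>: "\<alpha> \<in> presheaf_nat T X Y"
  obtains h where "h \<in> nex (T\<^sub>0 X) Y"
    "\<And>D a s. D \<in> FinDisc \<Longrightarrow> a \<in> nex D X \<Longrightarrow> s \<in> pts (T\<^sub>0 D) \<Longrightarrow> h (T\<^sub>1 D X a s) = \<alpha> D a s"
proof -
  have "\<alpha> \<in> lan_comparison T T (\<lambda>D. ident (T\<^sub>0 D)) X ` nex (T\<^sub>0 X) Y"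
    using bij_betw_imp_surj_on[OF comparison_bij[OF X Y]] \<alpha> by simp
  then obtain h where h: "h \<in> nex (T\<^sub>0 X) Y"
    and \<alpha>_eq: "\<alpha> = lan_comparison T T (\<lambda>D. ident (T\<^sub>0 D)) X h"
    by (rule imageE)
  show thesis
    by (rule that[OF h]) (simp add: \<alpha>_eq lan_comparison_pt)
qed

lemma maps_determined_on_finite:
  assumes X: "X \<in> K" and Y: "Y \<in> K" and h: "h \<in> nex (T\<^sub>0 X) Y" and h': "h' \<in> nex (T\<^sub>0 X) Y"
    and eq: "\<And>D a s. D \<in> FinDisc \<Longrightarrow> a \<in> nex D X \<Longrightarrow> s \<in> pts (T\<^sub>0 D) \<Longrightarrow>
      h (T\<^sub>1 D X a s) = h' (T\<^sub>1 D X a s)"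
  shows "h = h'"
proof (rule inj_onD[OF bij_betw_imp_inj_on[OF comparison_bij[OF X Y]] _ h h'])
  show "lan_comparison T T (\<lambda>D. ident (T\<^sub>0 D)) X h = lan_comparison T T (\<lambda>D. ident (T\<^sub>0 D)) X h'"
    unfolding lan_comparison_def
    by (intro restrict_ext compose_cong_pt) (simp add: compose_eq eq)
qed

lemma presheaf_natI:
  assumes nex: "\<And>D a. D \<in> FinDisc \<Longrightarrow> a \<in> nex D X \<Longrightarrow> \<alpha> D a \<in> nex (T\<^sub>0 D) Y"
    and dst: "\<And>D a b s. D \<in> FinDisc \<Longrightarrow> a \<in> nex D X \<Longrightarrow> b \<in> nex D X \<Longrightarrow> s \<in> pts (T\<^sub>0 D) \<Longrightarrow>
      edst Y (\<alpha> D a s) (\<alpha> D b s) \<le> sup_dst D X a b"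
    and nat: "\<And>D D' u a s. D \<in> FinDisc \<Longrightarrow> D' \<in> FinDisc \<Longrightarrow> u \<in> nex D' D \<Longrightarrow> a \<in> nex D X \<Longrightarrow>
      s \<in> pts (T\<^sub>0 D') \<Longrightarrow> \<alpha> D' (compose (pts D') a u) s = \<alpha> D a (T\<^sub>1 D' D u s)"
  shows "(\<lambda>D\<in>FinDisc. \<lambda>a\<in>nex D X. \<alpha> D a) \<in> presheaf_nat T X Y"
proof -
  have "\<alpha> D' (compose (pts D') a u) = compose (pts (T\<^sub>0 D')) (\<alpha> D a) (T\<^sub>1 D' D u)"
    if D: "D \<in> FinDisc" and D': "D' \<in> FinDisc" and u: "u \<in> nex D' D" and a: "a \<in> nex D X"
    for D D' u a
    by (rule nex_eqI[OF nex[OF D' nex_compose[OF u a]] nex_compose[OF T_nex[OF _ _ u] nex[OF D a]]])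
      (use that in \<open>auto simp: compose_eq nat\<close>)
  then show ?thesis
    unfolding presheaf_nat_def using nex dst
    by (auto simp: nex_compose intro!: sup_dst_least)
qed

text \<open>
  Since the base category is closed under subspaces, the union \<open>Z\<close> of the images of the \<open>T a\<close> is an
  object. The maps \<open>T a\<close> corestrict to \<open>Z\<close>, so they induce a map from \<open>T X\<close> to \<open>Z\<close>; followed by
  the inclusion it agrees with the identity on all \<open>T a\<close>, hence is the identity, and \<open>Z\<close> is
  everything. Hence no closure (limit) process enters, and elements of \<open>T X\<close> are finitary terms.
\<close>

lemma finite_support_FinDisc:
  assumes X: "X \<in> K" and t: "t \<in> pts (T\<^sub>0 X)"
  shows "\<exists>D\<in>FinDisc. \<exists>a\<in>nex D X. \<exists>s\<in>pts (T\<^sub>0 D). t = T\<^sub>1 D X a s"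
proof -
  define Z where "Z = {T\<^sub>1 D X a s | D a s. D \<in> FinDisc \<and> a \<in> nex D X \<and> s \<in> pts (T\<^sub>0 D)}"
  have ZI: "T\<^sub>1 D X a s \<in> Z" if "D \<in> FinDisc" "a \<in> nex D X" "s \<in> pts (T\<^sub>0 D)" for D a s
    using that unfolding Z_def by blast
  have Z_sub: "Z \<subseteq> pts (T\<^sub>0 X)"
    unfolding Z_def using T_pt X by auto
  let ?Z = "subsp (T\<^sub>0 X) Z"
  have ZK: "?Z \<in> K"
    using subspace[OF T_in[OF X] Z_sub] .
  have "(\<lambda>D\<in>FinDisc. \<lambda>a\<in>nex D X. T\<^sub>1 D X a) \<in> presheaf_nat T X ?Z"
  proof (rule presheaf_natI)
    fix D a assume D: "D \<in> FinDisc" and a: "a \<in> nex D X"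
    have Ta: "T\<^sub>1 D X a \<in> nex (T\<^sub>0 D) (T\<^sub>0 X)"
      using D a X by (simp add: T_nex)
    show "T\<^sub>1 D X a \<in> nex (T\<^sub>0 D) ?Z"
    proof (rule nexI)
      show "T\<^sub>1 D X a \<in> extensional (pts (T\<^sub>0 D))"
        using Ta by (simp add: nex_def PiE_iff)
    qed (use ZI[OF D a] nex_dst[OF Ta] in auto)
  next
    fix D a b s assume "D \<in> FinDisc" "a \<in> nex D X" "b \<in> nex D X" "s \<in> pts (T\<^sub>0 D)"
    then show "edst ?Z (T\<^sub>1 D X a s) (T\<^sub>1 D X b s) \<le> sup_dst D X a b"
      using X by (simp add: ZI T_enriched)
  qed (use X in \<open>simp add: T_comp\<close>)
  then obtain h where h: "h \<in> nex (T\<^sub>0 X) ?Z"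
    and h_eq: "\<And>D a s. D \<in> FinDisc \<Longrightarrow> a \<in> nex D X \<Longrightarrow> s \<in> pts (T\<^sub>0 D) \<Longrightarrow>
      h (T\<^sub>1 D X a s) = (\<lambda>D\<in>FinDisc. \<lambda>a\<in>nex D X. T\<^sub>1 D X a) D a s"
    using presheaf_nat_induces_map[OF X ZK] by blast
  have h_in: "h p \<in> Z" if "p \<in> pts (T\<^sub>0 X)" for p
    using nex_pt[OF h that] by simp
  have h_nex: "h \<in> nex (T\<^sub>0 X) (T\<^sub>0 X)"
  proof (rule nexI)
    show "h \<in> extensional (pts (T\<^sub>0 X))"
      using h by (simp add: nex_def PiE_iff)
  qed (use h_in Z_sub nex_dst[OF h] in auto)
  have "h = ident (T\<^sub>0 X)"
    by (rule maps_determined_on_finite[OF X T_in[OF X] h_nex nex_ident])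
      (use X in \<open>simp add: h_eq T_pt\<close>)
  then have "t \<in> Z"
    using h_in[OF t] t by simp
  then show ?thesis
    unfolding Z_def by blast
qed

lemma finite_support:
  assumes X: "X \<in> K" and t: "t \<in> pts (T\<^sub>0 X)"
  obtains n c \<sigma> where "\<sigma> \<in> pts (T\<^sub>0 (V n))" "\<And>i. i < n \<Longrightarrow> c i \<in> pts X"
    "t = T\<^sub>1 (V n) X (vmap n c) \<sigma>"
proof -
  obtain D a s where D: "D \<in> FinDisc" and a: "a \<in> nex D X" and s: "s \<in> pts (T\<^sub>0 D)"
    and t: "t = T\<^sub>1 D X a s"
    using finite_support_FinDisc[OF assms] by blast
  show thesis
    by (rule that[OF T_coord_pt[OF D s], of "\<lambda>i. a (enum D i)"])
      (use D a s t X in \<open>simp_all add: T_enum_coord nex_pt enum_pt\<close>)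
qed

subsection \<open>Algebras of the associated variety\<close>

abbreviation \<Sigma> :: "(nat \<times> 'u) signature" where "\<Sigma> \<equiv> assoc_sig x T"
abbreviation \<V> :: "('u, nat \<times> 'u) qalg set" where "\<V> \<equiv> assoc_variety K x T"

lemma sig_simps [simp]:
  "(n, \<sigma>) \<in> syms \<Sigma> \<longleftrightarrow> \<sigma> \<in> pts (T\<^sub>0 (V n))" "arity \<Sigma> s = fst s"
  by (simp_all add: assoc_sig_def)

lemma map_upt_tuples: "map c [0..<n] \<in> tuples n A \<longleftrightarrow> (\<forall>i<n. c i \<in> A)"
  by (auto simp: tuples_def)

lemma tuples_as_map_upt:
  assumes "as \<in> tuples n A"
  shows "map ((!) as) [0..<n] = as" "\<And>i. i < n \<Longrightarrow> as ! i \<in> A"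
  using assms by (auto simp: tuples_def map_nth subset_iff)

text \<open>Value of the term \<open>\<sigma>(x\<^sub>0, \<dots>, x\<^sub>n\<^sub>-\<^sub>1)\<close> when \<open>x\<^sub>i\<close> is assigned \<open>c i\<close>.\<close>

definition app :: "('u, nat \<times> 'u) qalg \<Rightarrow> nat \<Rightarrow> 'u \<Rightarrow> (nat \<Rightarrow> 'u) \<Rightarrow> 'u" where
  "app A n \<sigma> c = op_of A (n, \<sigma>) (map c [0..<n])"

lemma term_val_sym_tm: "term_val A f (sym_tm n \<sigma>) = app A n \<sigma> f"
  by (simp add: sym_tm_def app_def comp_def)

lemma app_cong: "(\<And>i. i < n \<Longrightarrow> c i = d i) \<Longrightarrow> app A n \<sigma> c = app A n \<sigma> d"
  unfolding app_def by (metis atLeastLessThan_iff atLeastLessThan_upt map_cong)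

lemma tuple_dst_upt:
  "tuple_dst X (map c [0..<n]) (map d [0..<n]) = (SUP i\<in>{..<n}. edst X (c i) (d i))"
  by (simp add: tuple_dst_def)

lemma hom_app:
  assumes "h \<in> alg_hom \<Sigma> A B" "\<sigma> \<in> pts (T\<^sub>0 (V n))" "\<And>i. i < n \<Longrightarrow> c i \<in> pts (sp A)"
  shows "h (app A n \<sigma> c) = app B n \<sigma> (\<lambda>i. h (c i))"
  using alg_hom_op[OF assms(1), of "(n, \<sigma>)" "map c [0..<n]"] assms(2,3)
  by (simp add: app_def map_upt_tuples comp_def)

lemma homI:
  assumes "h \<in> nex (sp A) (sp B)"
    and "\<And>n \<sigma> c. \<sigma> \<in> pts (T\<^sub>0 (V n)) \<Longrightarrow> (\<And>i. i < n \<Longrightarrow> c i \<in> pts (sp A)) \<Longrightarrow>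
      h (app A n \<sigma> c) = app B n \<sigma> (\<lambda>i. h (c i))"
  shows "h \<in> alg_hom \<Sigma> A B"
proof -
  have "h (op_of A s as) = op_of B s (map h as)"
    if s: "s \<in> syms \<Sigma>" and as: "as \<in> tuples (arity \<Sigma> s) (pts (sp A))" for s as
  proof -
    obtain n \<sigma> where s_eq: "s = (n, \<sigma>)"
      by fastforce
    then have as': "as \<in> tuples n (pts (sp A))" and \<sigma>: "\<sigma> \<in> pts (T\<^sub>0 (V n))"
      using s as by auto
    have "map (\<lambda>i. h (as ! i)) [0..<n] = map h (map ((!) as) [0..<n])"
      by simp
    then show ?thesis
      using assms(2)[of \<sigma> n "(!) as"] \<sigma> tuples_as_map_upt[OF as'] by (simp add: app_def s_eq)
  qed
  then show ?thesis
    using assms(1) unfolding alg_hom_def by blast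
qed

lemma variety_quant_alg: "A \<in> \<V> \<Longrightarrow> quant_alg K \<Sigma> A"
  unfolding assoc_variety_def variety_def by blast

lemma variety_sp: "A \<in> \<V> \<Longrightarrow> sp A \<in> K"
  by (rule quant_alg_sp[OF variety_quant_alg])

lemma app_pt:
  "A \<in> \<V> \<Longrightarrow> \<sigma> \<in> pts (T\<^sub>0 (V n)) \<Longrightarrow> (\<And>i. i < n \<Longrightarrow> c i \<in> pts (sp A)) \<Longrightarrow>
   app A n \<sigma> c \<in> pts (sp A)"
  unfolding app_def by (rule quant_alg_op[OF variety_quant_alg]) (auto simp: map_upt_tuples)

lemma app_dst:
  assumes "A \<in> \<V>" "\<sigma> \<in> pts (T\<^sub>0 (V n))" "\<And>i. i < n \<Longrightarrow> c i \<in> pts (sp A)"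
    "\<And>i. i < n \<Longrightarrow> d i \<in> pts (sp A)"
  shows "edst (sp A) (app A n \<sigma> c) (app A n \<sigma> d) \<le> (SUP i\<in>{..<n}. edst (sp A) (c i) (d i))"
proof -
  have "\<forall>s\<in>syms \<Sigma>. \<forall>as\<in>tuples (arity \<Sigma> s) (pts (sp A)). \<forall>bs\<in>tuples (arity \<Sigma> s) (pts (sp A)).
        edst (sp A) (op_of A s as) (op_of A s bs) \<le> tuple_dst (sp A) as bs"
    using variety_quant_alg[OF assms(1)] unfolding quant_alg_def by blast
  from this[rule_format, of "(n, \<sigma>)" "map c [0..<n]" "map d [0..<n]"] show ?thesis
    using assms(2-4) by (simp add: app_def map_upt_tuples tuple_dst_upt)
qed

text \<open>
  Satisfaction quantifies over assignments of all variables, whereas only those in \<open>l\<close> and \<open>r\<close> matter.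
  The others are sent to a point \<open>p\<close>, whose existence excludes the vacuous case of an empty algebra.
\<close>

lemma satisfies_partial:
  assumes A: "A \<in> \<V>" and e: "(l, \<epsilon>, r) \<in> assoc_eqs x T"
    and c: "\<And>i. i < n \<Longrightarrow> c i \<in> pts (sp A)" and p: "p \<in> pts (sp A)"
  shows "edst (sp A) (term_val A (\<lambda>i. if i < n then c i else p) l)
    (term_val A (\<lambda>i. if i < n then c i else p) r) \<le> ennreal (of_rat \<epsilon>)"
proof -
  have "satisfies A (l, \<epsilon>, r)"
    using A e unfolding assoc_variety_def variety_def by blast
  moreover have "range (\<lambda>i. if i < n then c i else p) \<subseteq> pts (sp A)"
    using c p by auto
  ultimately show ?thesis
    unfolding satisfies_def by blast
qed

text \<open>
  Quantitative equations have rational \<open>\<epsilon>\<close>, while distances are arbitrary; density of the rationals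
  bridges the gap.
\<close>

lemma le_if_le_rat_bounds:
  fixes d e :: ennreal
  assumes "\<And>q::rat. q \<ge> 0 \<Longrightarrow> d \<le> ennreal (of_rat q) \<Longrightarrow> e \<le> ennreal (of_rat q)"
  shows "e \<le> d"
proof (rule ccontr)
  assume "\<not> e \<le> d"
  then obtain q :: rat where q: "d < ennreal (of_rat q)" "ennreal (of_rat q) < e"
    using ennreal_rat_dense[of d e] by (auto simp: not_le)
  have "q \<ge> 0"
  proof (rule ccontr)
    assume "\<not> q \<ge> 0"
    then have "ennreal (of_rat q) = 0"
      by (simp add: ennreal_neg)
    then show False
      using q(1) by simp
  qed
  then have "e \<le> ennreal (of_rat q)"
    using q(1) by (intro assms) simp_all
  then show False
    using q(2) by simp
qed

text \<open>
  The first family of equations gives this bound up to every rational above the distance of \<open>\<sigma>\<close> and \<open>\<tau>\<close>.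
\<close>

lemma app_dst_sym:
  assumes A: "A \<in> \<V>" and \<sigma>: "\<sigma> \<in> pts (T\<^sub>0 (V n))" and \<tau>: "\<tau> \<in> pts (T\<^sub>0 (V n))"
    and c: "\<And>i. i < n \<Longrightarrow> c i \<in> pts (sp A)"
  shows "edst (sp A) (app A n \<sigma> c) (app A n \<tau> c) \<le> edst (T\<^sub>0 (V n)) \<sigma> \<tau>"
proof (rule le_if_le_rat_bounds)
  fix q :: rat assume q: "q \<ge> 0" "edst (T\<^sub>0 (V n)) \<sigma> \<tau> \<le> ennreal (of_rat q)"
  let ?p = "app A n \<sigma> c"
  let ?f = "\<lambda>i. if i < n then c i else ?p"
  have e: "(sym_tm n \<sigma>, q, sym_tm n \<tau>) \<in> assoc_eqs x T"
    unfolding assoc_eqs_def using \<sigma> \<tau> q by blast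
  have "?p \<in> pts (sp A)"
    by (rule app_pt[OF A \<sigma>]) (rule c)
  then have "edst (sp A) (app A n \<sigma> ?f) (app A n \<tau> ?f) \<le> ennreal (of_rat q)"
    using satisfies_partial[OF A e, of n c ?p] c by (simp add: term_val_sym_tm)
  also have "app A n \<sigma> ?f = app A n \<sigma> c"
    by (rule app_cong) simp
  also have "app A n \<tau> ?f = app A n \<tau> c"
    by (rule app_cong) simp
  finally show "edst (sp A) (app A n \<sigma> c) (app A n \<tau> c) \<le> ennreal (of_rat q)" .
qed

lemma kl_ext_bind: "\<sigma> \<in> pts (T\<^sub>0 (V n)) \<Longrightarrow> kl_ext x T n m k \<sigma> = bind (V n) (V m) k \<sigma>"
  by (simp add: kl_ext_def bind_def compose_eq)

text \<open>The content of the second family of equations: Kleisli extension of symbols is substitution.\<close>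

lemma app_bind:
  assumes A: "A \<in> \<V>" and \<sigma>: "\<sigma> \<in> pts (T\<^sub>0 (V n))" and k: "\<And>i. i < n \<Longrightarrow> k i \<in> pts (T\<^sub>0 (V m))"
    and c: "\<And>j. j < m \<Longrightarrow> c j \<in> pts (sp A)"
  shows "app A m (bind (V n) (V m) (vmap n k) \<sigma>) c = app A n \<sigma> (\<lambda>i. app A m (k i) c)"
proof -
  let ?\<tau> = "bind (V n) (V m) (vmap n k) \<sigma>"
  have kn: "vmap n k \<in> nex (V n) (T\<^sub>0 (V m))"
    using k by (simp add: vmap_nex)
  then have \<tau>: "?\<tau> \<in> pts (T\<^sub>0 (V m))"
    using \<sigma> by (simp add: bind_pt)
  let ?p = "app A m ?\<tau> c"
  let ?f = "\<lambda>i. if i < m then c i else ?p"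
  let ?r = "App (n, \<sigma>) (map (\<lambda>i. sym_tm m (vmap n k (x i))) [0..<n])"
  have "vmap n k \<in> pts (V n) \<rightarrow>\<^sub>E pts (T\<^sub>0 (V m))"
    using kn unfolding nex_def by blast
  then have e: "(sym_tm m (kl_ext x T n m (vmap n k) \<sigma>), 0, ?r) \<in> assoc_eqs x T"
    unfolding assoc_eqs_def using \<sigma> by blast
  have f_eq: "app A m \<rho> ?f = app A m \<rho> c" for \<rho>
    by (rule app_cong) simp
  have val_l: "term_val A ?f (sym_tm m (kl_ext x T n m (vmap n k) \<sigma>)) = app A m ?\<tau> c"
    using \<sigma> by (simp add: term_val_sym_tm f_eq kl_ext_bind)
  have "term_val A ?f ?r = app A n \<sigma> (\<lambda>i. app A m (vmap n k (x i)) c)"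
    by (simp add: term_val_sym_tm f_eq comp_def app_def[of A n])
  also have "\<dots> = app A n \<sigma> (\<lambda>i. app A m (k i) c)"
    by (rule app_cong) simp
  finally have val_r: "term_val A ?f ?r = app A n \<sigma> (\<lambda>i. app A m (k i) c)" .
  have "?p \<in> pts (sp A)"
    by (rule app_pt[OF A \<tau>]) (rule c)
  then have "edst (sp A) (app A m ?\<tau> c) (app A n \<sigma> (\<lambda>i. app A m (k i) c)) \<le> 0"
    using satisfies_partial[OF A e, of m c ?p] c unfolding val_l val_r by simp
  then show ?thesis
    by (rule ext_metric_eqD[OF metric[OF variety_sp[OF A]], rotated 2])
      (use A \<sigma> \<tau> k c in \<open>auto intro!: app_pt\<close>)
qed

lemma app_eta:
  assumes A: "A \<in> \<V>" and i: "i < n" and c: "\<And>i. i < n \<Longrightarrow> c i \<in> pts (sp A)"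
  shows "app A n (eta T (V n) (x i)) c = c i"
proof -
  let ?f = "\<lambda>j. if j < n then c j else c i"
  have e: "(sym_tm n (eta T (V n) (x i)), 0, Var i) \<in> assoc_eqs x T"
    unfolding assoc_eqs_def using i by blast
  have "edst (sp A) (app A n (eta T (V n) (x i)) ?f) (c i) \<le> 0"
    using satisfies_partial[OF A e, of n c "c i"] c i by (simp add: term_val_sym_tm)
  also have "app A n (eta T (V n) (x i)) ?f = app A n (eta T (V n) (x i)) c"
    by (rule app_cong) simp
  finally show ?thesis
    by (rule ext_metric_eqD[OF metric[OF variety_sp[OF A]], rotated 2])
      (use A i c in \<open>auto intro!: app_pt eta_pt simp: pts_V\<close>)
qed

text \<open>
  Renaming variables by \<open>z\<close> is the substitution of the variables \<open>x (z i)\<close>, as \<open>T z\<close> is the Kleisli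
  extension of the unit after \<open>z\<close>. This makes \<open>app\<close> natural in the arity.
\<close>

lemma app_rename:
  assumes A: "A \<in> \<V>" and \<sigma>: "\<sigma> \<in> pts (T\<^sub>0 (V n))" and z: "z \<in> nex (V n) (V m)"
    and c: "\<And>v. v \<in> pts (V m) \<Longrightarrow> c v \<in> pts (sp A)"
  shows "app A m (T\<^sub>1 (V n) (V m) z \<sigma>) (\<lambda>j. c (x j)) = app A n \<sigma> (\<lambda>i. c (z (x i)))"
proof -
  have zx: "z (x i) \<in> pts (V m)" if "i < n" for i
    using nex_pt[OF z] that by (simp add: pts_V)
  have zn: "vmap n (\<lambda>i. z (x i)) = z"
    using z by (intro vmap_ext) (simp add: nex_def PiE_iff)
  have "T\<^sub>1 (V n) (V m) z \<sigma> = bind (V n) (V m) (vmap n (\<lambda>i. eta T (V m) (z (x i)))) \<sigma>"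
    using T_as_bind[OF V_in V_in z \<sigma>] compose_vmap[of n "eta T (V m)" "\<lambda>i. z (x i)"]
    unfolding zn by simp
  then have "app A m (T\<^sub>1 (V n) (V m) z \<sigma>) (\<lambda>j. c (x j)) =
      app A n \<sigma> (\<lambda>i. app A m (eta T (V m) (z (x i))) (\<lambda>j. c (x j)))"
    using app_bind[OF A \<sigma>, of "\<lambda>i. eta T (V m) (z (x i))" m "\<lambda>j. c (x j)"] zx c
    by (simp add: eta_pt pts_V)
  also have "\<dots> = app A n \<sigma> (\<lambda>i. c (z (x i)))"
  proof (rule app_cong)
    fix i assume "i < n"
    then obtain j where "j < m" "z (x i) = x j"
      using zx[of i] by (auto simp: pts_V)
    then show "app A m (eta T (V m) (z (x i))) (\<lambda>j. c (x j)) = c (z (x i))"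
      using app_eta[OF A, of j m "\<lambda>j. c (x j)"] c by (simp add: pts_V)
  qed
  finally show ?thesis .
qed


subsection \<open>The values of the functor as algebras\<close>

definition falg :: "'u emetric \<Rightarrow> ('u, nat \<times> 'u) qalg" where
  "falg X = \<lparr>sp = T\<^sub>0 X, op_of = (\<lambda>s as.
     if s \<in> syms \<Sigma> \<and> as \<in> tuples (fst s) (pts (T\<^sub>0 X))
     then bind (V (fst s)) X (vmap (fst s) ((!) as)) (snd s) else undefined)\<rparr>"

lemma sp_falg [simp]: "sp (falg X) = T\<^sub>0 X"
  by (simp add: falg_def)

lemma app_falg:
  assumes "\<sigma> \<in> pts (T\<^sub>0 (V n))" "\<And>i. i < n \<Longrightarrow> c i \<in> pts (T\<^sub>0 X)"
  shows "app (falg X) n \<sigma> c = bind (V n) X (vmap n c) \<sigma>"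
proof -
  have "vmap n ((!) (map c [0..<n])) = vmap n c"
    by (rule vmap_cong) simp
  then show ?thesis
    using assms by (simp add: app_def falg_def map_upt_tuples)
qed

lemma falg_quant_alg:
  assumes X: "X \<in> K"
  shows "quant_alg K \<Sigma> (falg X)"
proof -
  have op: "op_of (falg X) (n, \<sigma>) as = bind (V n) X (vmap n ((!) as)) \<sigma>"
    "vmap n ((!) as) \<in> nex (V n) (T\<^sub>0 X)"
    if "\<sigma> \<in> pts (T\<^sub>0 (V n))" "as \<in> tuples n (pts (T\<^sub>0 X))" for n \<sigma> as
    using that X by (auto simp: falg_def intro!: vmap_nex tuples_as_map_upt(2))
  have "edst (T\<^sub>0 X) (op_of (falg X) (n, \<sigma>) as) (op_of (falg X) (n, \<sigma>) bs) \<le> tuple_dst (T\<^sub>0 X) as bs"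
    if \<sigma>: "\<sigma> \<in> pts (T\<^sub>0 (V n))" and as: "as \<in> tuples n (pts (T\<^sub>0 X))" and bs: "bs \<in> tuples n (pts (T\<^sub>0 X))"
    for n \<sigma> as bs
  proof -
    have "length as = n"
      using as by (simp add: tuples_def)
    then show ?thesis
      using bind_enriched[OF V_in X op(2)[OF \<sigma> as] op(2)[OF \<sigma> bs] \<sigma>]
      by (simp add: op(1)[OF \<sigma> as] op(1)[OF \<sigma> bs] sup_dst_vmap tuple_dst_def)
  qed
  moreover have "op_of (falg X) (n, \<sigma>) as \<in> pts (T\<^sub>0 X)"
    if "\<sigma> \<in> pts (T\<^sub>0 (V n))" "as \<in> tuples n (pts (T\<^sub>0 X))" for n \<sigma> as
    using op[OF that] that X by (simp add: bind_pt)
  moreover have "op_of (falg X) s as = undefined"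
    if "s \<notin> syms \<Sigma> \<or> as \<notin> tuples (fst s) (pts (T\<^sub>0 X))" for s as
    using that by (auto simp: falg_def)
  ultimately show ?thesis
    unfolding quant_alg_def using X by (auto simp: assoc_sig_def)
qed

text \<open>
  The three families of equations express, for the operations \<open>bind\<close>, that Kleisli extensions are
  nonexpanding, compose associatively, and restrict along the unit to the given map.
\<close>

lemma falg_in_variety:
  assumes X: "X \<in> K"
  shows "falg X \<in> \<V>"
proof -
  have sat: "satisfies (falg X) e" if e: "e \<in> assoc_eqs x T" for e
  proof -
    obtain l \<epsilon> r where e_eq: "e = (l, \<epsilon>, r)"
      by (cases e)
    have "edst (T\<^sub>0 X) (term_val (falg X) f l) (term_val (falg X) f r) \<le> ennreal (of_rat \<epsilon>)"
      if f: "range f \<subseteq> pts (T\<^sub>0 X)" for f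
    proof -
      have fp: "f i \<in> pts (T\<^sub>0 X)" for i
        using f by blast
      have fn: "vmap n f \<in> nex (V n) (T\<^sub>0 X)" for n
        using X fp by (simp add: vmap_nex)
      have val: "term_val (falg X) f (sym_tm n \<sigma>) = bind (V n) X (vmap n f) \<sigma>"
        if "\<sigma> \<in> pts (T\<^sub>0 (V n))" for n \<sigma>
        using that fp by (simp add: term_val_sym_tm app_falg)
      have zero: "edst (T\<^sub>0 X) p q = 0" if "p = q" "p \<in> pts (T\<^sub>0 X)" for p q
        using metric[OF T_in[OF X]] that unfolding ext_metric_def by blast
      consider (dst) n \<sigma> \<tau> where "l = sym_tm n \<sigma>" "r = sym_tm n \<tau>" "\<sigma> \<in> pts (T\<^sub>0 (V n))"
          "\<tau> \<in> pts (T\<^sub>0 (V n))" "edst (T\<^sub>0 (V n)) \<sigma> \<tau> \<le> ennreal (of_rat \<epsilon>)"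
        | (subst) n m \<sigma> k where "l = sym_tm m (kl_ext x T n m k \<sigma>)"
          "r = App (n, \<sigma>) (map (\<lambda>i. sym_tm m (k (x i))) [0..<n])" "\<sigma> \<in> pts (T\<^sub>0 (V n))"
          "k \<in> pts (V n) \<rightarrow>\<^sub>E pts (T\<^sub>0 (V m))"
        | (unit) n i where "l = sym_tm n (eta T (V n) (x i))" "r = Var i" "i < n"
        using e unfolding assoc_eqs_def e_eq by blast
      then show ?thesis
      proof cases
        case dst
        have "edst (T\<^sub>0 X) (term_val (falg X) f l) (term_val (falg X) f r)
            \<le> edst (T\<^sub>0 (V n)) \<sigma> \<tau>"
          using dst X fn by (simp add: val bind_dst)
        then show ?thesis
          using dst(5) by (rule order_trans)
      next
        case subst
        have k: "k \<in> nex (V n) (T\<^sub>0 (V m))"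
          using subst(4) by (intro nex_FinDisc) (auto simp: Vsp_in_FinDisc)
        have kx: "k (x i) \<in> pts (T\<^sub>0 (V m))" if "i < n" for i
          using nex_pt[OF k] that by (simp add: pts_V)
        have \<tau>: "bind (V n) (V m) k \<sigma> \<in> pts (T\<^sub>0 (V m))"
          using k subst(3) by (simp add: bind_pt)
        let ?c = "\<lambda>i. bind (V m) X (vmap m f) (k (x i))"
        have c: "?c i \<in> pts (T\<^sub>0 X)" if "i < n" for i
          using kx[OF that] X fn by (simp add: bind_pt)
        have "map (term_val (falg X) f) (map (\<lambda>i. sym_tm m (k (x i))) [0..<n]) = map ?c [0..<n]"
          by (simp add: val kx)
        then have "term_val (falg X) f r = app (falg X) n \<sigma> ?c"
          unfolding subst(2) app_def by (simp only: term_val.simps)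
        also have "\<dots> = bind (V n) X (vmap n ?c) \<sigma>"
          using subst(3) c by (simp add: app_falg)
        also have "vmap n ?c = compose (pts (V n)) (bind (V m) X (vmap m f)) k"
          using compose_vmap[of n "bind (V m) X (vmap m f)" "\<lambda>i. k (x i)"] vmap_ext[of k n] subst(4)
          by (simp add: PiE_iff)
        also have "bind (V n) X \<dots> \<sigma> = term_val (falg X) f l"
          using bind_bind[OF V_in V_in X k fn subst(3)]
          unfolding subst(1) by (simp add: val \<tau> kl_ext_bind subst(3))
        finally have "term_val (falg X) f l = term_val (falg X) f r"
          by simp
        moreover have "term_val (falg X) f l \<in> pts (T\<^sub>0 X)"
          using \<tau> X fn unfolding subst(1) by (simp add: val kl_ext_bind subst(3) bind_pt)
        ultimately show ?thesis
          using zero by simp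
      next
        case unit
        have i: "x i \<in> pts (V n)"
          using unit(3) by (simp add: pts_V)
        then have "term_val (falg X) f l = f i"
          unfolding unit(1) using X fn unit(3) by (simp add: val eta_pt bind_eta)
        then show ?thesis
          using unit(2) fp zero by simp
      qed
    qed
    then show ?thesis
      unfolding satisfies_def e_eq by simp
  qed
  show ?thesis
    unfolding assoc_variety_def variety_def using falg_quant_alg[OF X] sat by blast
qed

lemma T_hom:
  assumes X: "X \<in> K" and Y: "Y \<in> K" and f: "f \<in> nex X Y"
  shows "T\<^sub>1 X Y f \<in> alg_hom \<Sigma> (falg X) (falg Y)"
proof (rule homI)
  fix n \<sigma> and c :: "nat \<Rightarrow> 'u"
  assume \<sigma>: "\<sigma> \<in> pts (T\<^sub>0 (V n))" and "\<And>i. i < n \<Longrightarrow> c i \<in> pts (sp (falg X))"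
  then have c: "\<And>i. i < n \<Longrightarrow> c i \<in> pts (T\<^sub>0 X)"
    by simp
  have "vmap n c \<in> nex (V n) (T\<^sub>0 X)"
    using X c by (simp add: vmap_nex)
  then show "T\<^sub>1 X Y f (app (falg X) n \<sigma> c) = app (falg Y) n \<sigma> (\<lambda>i. T\<^sub>1 X Y f (c i))"
    using assms \<sigma> c by (simp add: app_falg T_bind compose_vmap T_pt)
qed (simp add: T_nex assms)

lemma mu_hom:
  assumes X: "X \<in> K"
  shows "mu T X \<in> alg_hom \<Sigma> (falg (T\<^sub>0 X)) (falg X)"
proof (rule homI)
  fix n \<sigma> and c :: "nat \<Rightarrow> 'u"
  assume \<sigma>: "\<sigma> \<in> pts (T\<^sub>0 (V n))" and "\<And>i. i < n \<Longrightarrow> c i \<in> pts (sp (falg (T\<^sub>0 X)))"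
  then have c: "\<And>i. i < n \<Longrightarrow> c i \<in> pts (T\<^sub>0 (T\<^sub>0 X))"
    by simp
  have "vmap n c \<in> nex (V n) (T\<^sub>0 (T\<^sub>0 X))"
    using X c by (simp add: vmap_nex)
  then show "mu T X (app (falg (T\<^sub>0 X)) n \<sigma> c) = app (falg X) n \<sigma> (\<lambda>i. mu T X (c i))"
    using X \<sigma> c by (simp add: app_falg mu_bind compose_vmap nex_pt[OF mu_nex])
qed (simp add: mu_nex assms)


subsection \<open>Freeness\<close>

text \<open>
  By the unit law, \<open>T a\<close> is the Kleisli extension of \<open>\<eta> \<circ> a\<close>, which defines the operations of \<open>falg X\<close> on
  tuples of generators.
\<close>

lemma falg_generated:
  assumes "X \<in> K" "\<sigma> \<in> pts (T\<^sub>0 (V n))" "\<And>i. i < n \<Longrightarrow> c i \<in> pts X"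
  shows "T\<^sub>1 (V n) X (vmap n c) \<sigma> = app (falg X) n \<sigma> (\<lambda>i. eta T X (c i))"
  using assms by (simp add: T_as_bind vmap_nex app_falg eta_pt compose_vmap)

lemma hom_on_finite:
  assumes X: "X \<in> K" and h: "h \<in> alg_hom \<Sigma> (falg X) A"
    and \<sigma>: "\<sigma> \<in> pts (T\<^sub>0 (V n))" and c: "\<And>i. i < n \<Longrightarrow> c i \<in> pts X"
  shows "h (T\<^sub>1 (V n) X (vmap n c) \<sigma>) = app A n \<sigma> (\<lambda>i. h (eta T X (c i)))"
  using assms by (simp add: falg_generated hom_app[OF h] eta_pt)

lemma hom_unique:
  assumes X: "X \<in> K" and h: "h \<in> alg_hom \<Sigma> (falg X) A" and h': "h' \<in> alg_hom \<Sigma> (falg X) A"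
    and eq: "\<And>p. p \<in> pts X \<Longrightarrow> h (eta T X p) = h' (eta T X p)"
  shows "h = h'"
proof (rule nex_eqI[OF alg_hom_nex[OF h] alg_hom_nex[OF h']])
  fix t assume "t \<in> pts (sp (falg X))"
  then obtain n c \<sigma> where \<sigma>: "\<sigma> \<in> pts (T\<^sub>0 (V n))" and c: "\<And>i. i < n \<Longrightarrow> c i \<in> pts X"
    and t: "t = T\<^sub>1 (V n) X (vmap n c) \<sigma>"
    using finite_support[OF X] by (metis sp_falg)
  have "g t = app A n \<sigma> (\<lambda>i. g (eta T X (c i)))" if "g \<in> alg_hom \<Sigma> (falg X) A" for g
    unfolding t by (rule hom_on_finite[OF X that \<sigma>]) (rule c)
  moreover have "app A n \<sigma> (\<lambda>i. h (eta T X (c i))) = app A n \<sigma> (\<lambda>i. h' (eta T X (c i)))"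
    by (rule app_cong) (simp add: eq c)
  ultimately show "h t = h' t"
    using h h' by simp
qed

text \<open>
  For an algebra \<open>A\<close> and a map \<open>f\<close> from \<open>X\<close> to \<open>A\<close>, evaluating \<open>\<sigma>\<close> at the tuple \<open>f \<circ> a\<close> is nonexpanding in \<open>\<sigma>\<close>
  by the first family of equations, nonexpanding in \<open>a\<close> because operations are, and natural in the
  arity by \<open>app_rename\<close>. So it is an element of \<open>presheaf_nat T X A\<close>, and strong finitariness turns it
  into a map from \<open>T X\<close> to \<open>A\<close>.
\<close>

lemma evaluation_map:
  assumes X: "X \<in> K" and A: "A \<in> \<V>" and f: "f \<in> nex X (sp A)"
  obtains h where "h \<in> nex (T\<^sub>0 X) (sp A)"
    "\<And>n \<sigma> c. \<sigma> \<in> pts (T\<^sub>0 (V n)) \<Longrightarrow> (\<And>i. i < n \<Longrightarrow> c i \<in> pts X) \<Longrightarrow>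
      h (T\<^sub>1 (V n) X (vmap n c) \<sigma>) = app A n \<sigma> (\<lambda>i. f (c i))"
proof -
  define \<alpha> where "\<alpha> D a = (\<lambda>s\<in>pts (T\<^sub>0 D).
    app A (npts D) (T\<^sub>1 D (V (npts D)) (coord D) s) (\<lambda>i. f (a (enum D i))))" for D a
  have fp: "f (a (enum D i)) \<in> pts (sp A)" if "D \<in> FinDisc" "a \<in> nex D X" "i < npts D" for D a i
    using that by (intro nex_pt[OF f] nex_pt[of a D X] enum_pt)
  have \<alpha>_nat: "\<alpha> D' (compose (pts D') a u) s = \<alpha> D a (T\<^sub>1 D' D u s)"
    if D: "D \<in> FinDisc" and D': "D' \<in> FinDisc" and u: "u \<in> nex D' D" and a: "a \<in> nex D X"
      and s: "s \<in> pts (T\<^sub>0 D')" for D D' u a s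
  proof -
    let ?n = "npts D" and ?n' = "npts D'"
    \<comment> \<open>In coordinates, \<open>u\<close> becomes a map \<open>z\<close> between standard spaces, to which \<open>app_rename\<close> applies.\<close>
    define w where "w = compose (pts D') (coord D) u"
    define z where "z = vmap ?n' (\<lambda>i. w (enum D' i))"
    define c where "c = (\<lambda>v. f (a (vmap ?n (enum D) v)))"
    have w: "w \<in> nex D' (V ?n)"
      unfolding w_def by (rule nex_compose[OF u coord_nex[OF D]])
    have z: "z \<in> nex (V ?n') (V ?n)"
      unfolding z_def by (rule vmap_nex) (use D' in \<open>auto intro: nex_pt[OF w] enum_pt\<close>)
    have c: "c v \<in> pts (sp A)" if "v \<in> pts (V ?n)" for v
      unfolding c_def by (intro nex_pt[OF f] nex_pt[OF a] nex_pt[OF enum_nex[OF D]] that)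
    have cw: "c (w d) = f (a (u d))" if "d \<in> pts D'" for d
    proof -
      have "u d \<in> pts D"
        using nex_pt[OF u that] .
      then show ?thesis
        using D that by (simp add: c_def w_def compose_eq coord_def rank_less enum_rank)
    qed
    have us: "T\<^sub>1 D' D u s \<in> pts (T\<^sub>0 D)"
      using D D' u s by (simp add: T_pt)
    have "\<alpha> D a (T\<^sub>1 D' D u s) =
        app A ?n (T\<^sub>1 D (V ?n) (coord D) (T\<^sub>1 D' D u s)) (\<lambda>j. f (a (enum D j)))"
      using us by (simp add: \<alpha>_def)
    also have "T\<^sub>1 D (V ?n) (coord D) (T\<^sub>1 D' D u s) = T\<^sub>1 D' (V ?n) w s"
      using D D' u s coord_nex[OF D] by (simp add: T_comp w_def)
    also have "\<dots> = T\<^sub>1 (V ?n') (V ?n) z (T\<^sub>1 D' (V ?n') (coord D') s)"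
      unfolding z_def by (rule T_enum_coord[OF D' V_in w s, symmetric])
    also have "app A ?n \<dots> (\<lambda>j. f (a (enum D j))) = app A ?n \<dots> (\<lambda>j. c (x j))"
      by (rule app_cong) (simp add: c_def)
    also have "\<dots> = app A ?n' (T\<^sub>1 D' (V ?n') (coord D') s) (\<lambda>i. c (z (x i)))"
      by (rule app_rename[OF A T_coord_pt[OF D' s] z c])
    also have "\<dots> = app A ?n' (T\<^sub>1 D' (V ?n') (coord D') s) (\<lambda>i. f (compose (pts D') a u (enum D' i)))"
      by (rule app_cong) (simp add: z_def cw enum_pt[OF D'] compose_eq)
    also have "\<dots> = \<alpha> D' (compose (pts D') a u) s"
      using s by (simp add: \<alpha>_def)
    finally show ?thesis
      by simp
  qed
  have "(\<lambda>D\<in>FinDisc. \<lambda>a\<in>nex D X. \<alpha> D a) \<in> presheaf_nat T X (sp A)"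
  proof (rule presheaf_natI)
    fix D a assume D: "D \<in> FinDisc" and a: "a \<in> nex D X"
    show "\<alpha> D a \<in> nex (T\<^sub>0 D) (sp A)"
    proof (rule nexI)
      fix s assume s: "s \<in> pts (T\<^sub>0 D)"
      show "\<alpha> D a s \<in> pts (sp A)"
        using s by (simp add: \<alpha>_def app_pt[OF A T_coord_pt[OF D s]] fp[OF D a])
      fix t assume t: "t \<in> pts (T\<^sub>0 D)"
      have "edst (sp A) (\<alpha> D a s) (\<alpha> D a t) \<le> edst (T\<^sub>0 (V (npts D)))
          (T\<^sub>1 D (V (npts D)) (coord D) s) (T\<^sub>1 D (V (npts D)) (coord D) t)"
        using s t by (simp add: \<alpha>_def app_dst_sym[OF A T_coord_pt[OF D s] T_coord_pt[OF D t]] fp[OF D a])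
      also have "\<dots> \<le> edst (T\<^sub>0 D) s t"
        by (rule nex_dst[OF T_nex[OF _ _ coord_nex[OF D]] s t]) (simp_all add: D)
      finally show "edst (sp A) (\<alpha> D a s) (\<alpha> D a t) \<le> edst (T\<^sub>0 D) s t" .
    qed (simp add: \<alpha>_def)
  next
    fix D a b s
    assume D: "D \<in> FinDisc" and a: "a \<in> nex D X" and b: "b \<in> nex D X" and s: "s \<in> pts (T\<^sub>0 D)"
    have "edst (sp A) (\<alpha> D a s) (\<alpha> D b s)
        \<le> (SUP i\<in>{..<npts D}. edst (sp A) (f (a (enum D i))) (f (b (enum D i))))"
      using s by (simp add: \<alpha>_def app_dst[OF A T_coord_pt[OF D s]] fp[OF D a] fp[OF D b])
    also have "\<dots> \<le> sup_dst D X a b"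
    proof (rule SUP_least)
      fix i assume "i \<in> {..<npts D}"
      then have d: "enum D i \<in> pts D"
        using enum_pt[OF D] by simp
      have "edst (sp A) (f (a (enum D i))) (f (b (enum D i))) \<le> edst X (a (enum D i)) (b (enum D i))"
        by (rule nex_dst[OF f nex_pt[OF a d] nex_pt[OF b d]])
      also have "\<dots> \<le> sup_dst D X a b"
        by (rule sup_dst_upper[OF d])
      finally show "edst (sp A) (f (a (enum D i))) (f (b (enum D i))) \<le> sup_dst D X a b" .
    qed
    finally show "edst (sp A) (\<alpha> D a s) (\<alpha> D b s) \<le> sup_dst D X a b" .
  qed (rule \<alpha>_nat)
  then obtain h where h: "h \<in> nex (T\<^sub>0 X) (sp A)"
    and h_eq: "\<And>D a s. D \<in> FinDisc \<Longrightarrow> a \<in> nex D X \<Longrightarrow> s \<in> pts (T\<^sub>0 D) \<Longrightarrow>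
      h (T\<^sub>1 D X a s) = (\<lambda>D\<in>FinDisc. \<lambda>a\<in>nex D X. \<alpha> D a) D a s"
    using presheaf_nat_induces_map[OF X variety_sp[OF A]] by blast
  show thesis
  proof (rule that[OF h])
    fix n \<sigma> and c :: "nat \<Rightarrow> 'u"
    assume \<sigma>: "\<sigma> \<in> pts (T\<^sub>0 (V n))" and c: "\<And>i. i < n \<Longrightarrow> c i \<in> pts X"
    have D: "V n \<in> FinDisc"
      by (rule Vsp_in_FinDisc)
    have a: "vmap n c \<in> nex (V n) X"
      using c X by (simp add: vmap_nex)
    let ?m = "npts (V n)"
    have fc: "f (vmap n c v) \<in> pts (sp A)" if "v \<in> pts (V n)" for v
      by (intro nex_pt[OF f] nex_pt[OF a] that)
    \<comment> \<open>The chosen enumeration of \<open>V n\<close> may permute it, so renaming is needed even here.\<close>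
    have "h (T\<^sub>1 (V n) X (vmap n c) \<sigma>) =
        app A ?m (T\<^sub>1 (V n) (V ?m) (coord (V n)) \<sigma>) (\<lambda>i. f (vmap n c (enum (V n) i)))"
      using h_eq[OF D a \<sigma>] D a \<sigma> by (simp add: \<alpha>_def)
    also have "\<dots> = app A ?m (T\<^sub>1 (V n) (V ?m) (coord (V n)) \<sigma>)
        (\<lambda>i. f (vmap n c (vmap ?m (enum (V n)) (x i))))"
      by (rule app_cong) simp
    also have "\<dots> = app A n \<sigma> (\<lambda>i. f (vmap n c (vmap ?m (enum (V n)) (coord (V n) (x i)))))"
      by (rule app_rename[OF A \<sigma> coord_nex[OF D]]) (intro fc nex_pt[OF enum_nex[OF D]])
    also have "\<dots> = app A n \<sigma> (\<lambda>i. f (c i))"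
    proof (rule app_cong)
      fix i assume i: "i < n"
      then have "x i \<in> pts (V n)"
        by (simp add: pts_V)
      then show "f (vmap n c (vmap ?m (enum (V n)) (coord (V n) (x i)))) = f (c i)"
        using i D by (simp add: coord_def rank_less enum_rank)
    qed
    finally show "h (T\<^sub>1 (V n) X (vmap n c) \<sigma>) = app A n \<sigma> (\<lambda>i. f (c i))" .
  qed
qed

text \<open>
  The disjoint union of the supports of finitely many elements of \<open>T X\<close> supports all of them. It is
  realised as the standard space on the concatenation of the supporting tuples.
\<close>

lemma common_finite_support:
  fixes t :: "nat \<Rightarrow> 'u"
  assumes X: "X \<in> K"
  shows "(\<And>i. i < n \<Longrightarrow> t i \<in> pts (T\<^sub>0 X)) \<Longrightarrow>
    \<exists>m b \<rho>. (\<forall>j<m. b j \<in> pts X) \<and>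
      (\<forall>i<n. \<rho> i \<in> pts (T\<^sub>0 (V m)) \<and> t i = T\<^sub>1 (V m) X (vmap m b) (\<rho> i))"
proof (induction n)
  case 0
  then show ?case
    by (intro exI[of _ 0]) simp
next
  case (Suc n)
  then obtain m b \<rho> where b: "\<And>j. j < m \<Longrightarrow> b j \<in> pts X"
    and \<rho>: "\<And>i. i < n \<Longrightarrow> \<rho> i \<in> pts (T\<^sub>0 (V m))"
    and t: "\<And>i. i < n \<Longrightarrow> t i = T\<^sub>1 (V m) X (vmap m b) (\<rho> i)"
    by (metis less_SucI)
  have "t n \<in> pts (T\<^sub>0 X)"
    by (rule Suc.prems) simp
  then obtain k c \<sigma> where \<sigma>: "\<sigma> \<in> pts (T\<^sub>0 (V k))" and c: "\<And>i. i < k \<Longrightarrow> c i \<in> pts X"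
    and tn: "t n = T\<^sub>1 (V k) X (vmap k c) \<sigma>"
    by (rule finite_support[OF X]) (rule that)
  define e where "e j = (if j < m then b j else c (j - m))" for j
  have e: "e j \<in> pts X" if "j < m + k" for j
    using that b c by (auto simp: e_def)
  have en: "vmap (m + k) e \<in> nex (V (m + k)) X"
    using X e by (simp add: vmap_nex)
  have incl: "vmap q (\<lambda>j. x (j + r)) \<in> nex (V q) (V (m + k))" if "q + r \<le> m + k" for q r
    using that by (intro vmap_nex) (auto simp: pts_V)
  \<comment> \<open>A tuple found in \<open>e\<close> from position \<open>r\<close> on factors through \<open>e\<close> by shifting variables.\<close>
  have factor: "T\<^sub>1 (V (m + k)) X (vmap (m + k) e)
      (T\<^sub>1 (V q) (V (m + k)) (vmap q (\<lambda>j. x (j + r))) \<tau>) = T\<^sub>1 (V q) X (vmap q d) \<tau>"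
    if "q + r \<le> m + k" "\<tau> \<in> pts (T\<^sub>0 (V q))" "\<And>j. j < q \<Longrightarrow> e (j + r) = d j" for q r d \<tau>
  proof -
    have "vmap q (\<lambda>j. vmap (m + k) e (x (j + r))) = vmap q d"
      by (rule vmap_cong) (use that in simp)
    then show ?thesis
      using T_comp[OF V_in V_in X incl[OF that(1)] en that(2)] by (simp add: compose_vmap)
  qed
  define \<rho>' where "\<rho>' i = (if i < n then T\<^sub>1 (V m) (V (m + k)) (vmap m (\<lambda>j. x (j + 0))) (\<rho> i)
    else T\<^sub>1 (V k) (V (m + k)) (vmap k (\<lambda>j. x (j + m))) \<sigma>)" for i
  have "\<rho>' i \<in> pts (T\<^sub>0 (V (m + k)))" if "i < Suc n" for i
    unfolding \<rho>'_def using \<rho> \<sigma> incl[of m 0] incl[of k m] by (simp add: T_pt)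
  moreover have "t i = T\<^sub>1 (V (m + k)) X (vmap (m + k) e) (\<rho>' i)" if "i < Suc n" for i
  proof (cases "i < n")
    case True
    then show ?thesis
      using factor[of m 0 "\<rho> i" b] \<rho> t by (simp add: \<rho>'_def e_def)
  next
    case False
    then have "i = n"
      using that by simp
    then show ?thesis
      using factor[of k m \<sigma> c] \<sigma> tn by (simp add: \<rho>'_def e_def)
  qed
  ultimately show ?case
    using e by blast
qed

text \<open>
  The map of \<open>evaluation_map\<close> is a homomorphism: writing the arguments \<open>t i\<close> as \<open>T b (\<rho> i)\<close> with a common
  \<open>b\<close>, the value of \<open>\<sigma>\<close> at \<open>t\<close> is \<open>T b\<close> of the substitution of \<open>\<rho>\<close> into \<open>\<sigma>\<close>, which \<open>A\<close> respects.
\<close>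

lemma hom_extension:
  assumes X: "X \<in> K" and A: "A \<in> \<V>" and f: "f \<in> nex X (sp A)"
  obtains h where "h \<in> alg_hom \<Sigma> (falg X) A" "\<And>p. p \<in> pts X \<Longrightarrow> h (eta T X p) = f p"
proof -
  obtain h where h: "h \<in> nex (T\<^sub>0 X) (sp A)"
    and h_eq: "\<And>n \<sigma> c. \<sigma> \<in> pts (T\<^sub>0 (V n)) \<Longrightarrow> (\<And>i. i < n \<Longrightarrow> c i \<in> pts X) \<Longrightarrow>
      h (T\<^sub>1 (V n) X (vmap n c) \<sigma>) = app A n \<sigma> (\<lambda>i. f (c i))"
    using evaluation_map[OF assms] by blast
  have fp: "f p \<in> pts (sp A)" if "p \<in> pts X" for p
    using nex_pt[OF f that] .
  have "h \<in> alg_hom \<Sigma> (falg X) A"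
  proof (rule homI)
    fix n \<sigma> and t :: "nat \<Rightarrow> 'u"
    assume \<sigma>: "\<sigma> \<in> pts (T\<^sub>0 (V n))" and "\<And>i. i < n \<Longrightarrow> t i \<in> pts (sp (falg X))"
    then have t: "\<And>i. i < n \<Longrightarrow> t i \<in> pts (T\<^sub>0 X)"
      by simp
    have "\<exists>m b \<rho>. (\<forall>j<m. b j \<in> pts X) \<and>
        (\<forall>i<n. \<rho> i \<in> pts (T\<^sub>0 (V m)) \<and> t i = T\<^sub>1 (V m) X (vmap m b) (\<rho> i))"
      by (rule common_finite_support[OF X]) (rule t)
    then obtain m b \<rho> where b: "\<And>j. j < m \<Longrightarrow> b j \<in> pts X"
      and \<rho>: "\<And>i. i < n \<Longrightarrow> \<rho> i \<in> pts (T\<^sub>0 (V m))"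
      and t_eq: "\<And>i. i < n \<Longrightarrow> t i = T\<^sub>1 (V m) X (vmap m b) (\<rho> i)"
      by blast
    have bn: "vmap m b \<in> nex (V m) X" and \<rho>n: "vmap n \<rho> \<in> nex (V n) (T\<^sub>0 (V m))"
      using X b \<rho> by (simp_all add: vmap_nex)
    let ?\<tau> = "bind (V n) (V m) (vmap n \<rho>) \<sigma>"
    have \<tau>: "?\<tau> \<in> pts (T\<^sub>0 (V m))"
      using \<rho>n \<sigma> by (simp add: bind_pt)
    have "vmap n t = vmap n (\<lambda>i. T\<^sub>1 (V m) X (vmap m b) (\<rho> i))"
      by (rule vmap_cong) (rule t_eq)
    then have "app (falg X) n \<sigma> t = T\<^sub>1 (V m) X (vmap m b) ?\<tau>"
      using X bn \<rho>n \<sigma> t by (simp add: app_falg T_bind compose_vmap)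
    then have "h (app (falg X) n \<sigma> t) = app A m ?\<tau> (\<lambda>j. f (b j))"
      using h_eq[OF \<tau>, of b] b by simp
    also have "\<dots> = app A n \<sigma> (\<lambda>i. app A m (\<rho> i) (\<lambda>j. f (b j)))"
      by (rule app_bind[OF A \<sigma>]) (simp_all add: fp b \<rho>)
    also have "\<dots> = app A n \<sigma> (\<lambda>i. h (t i))"
      by (rule app_cong) (simp add: t_eq h_eq \<rho> b)
    finally show "h (app (falg X) n \<sigma> t) = app A n \<sigma> (\<lambda>i. h (t i))" .
  qed (simp add: h)
  moreover have "h (eta T X p) = f p" if p: "p \<in> pts X" for p
  proof -
    have x0: "x 0 \<in> pts (V 1)"
      by (simp add: pts_V)
    have pn: "vmap 1 (\<lambda>_. p) \<in> nex (V 1) X"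
      using X p by (simp add: vmap_nex)
    have "eta T X p = T\<^sub>1 (V 1) X (vmap 1 (\<lambda>_. p)) (eta T (V 1) (x 0))"
      using eta_natural[OF V_in X pn x0] by simp
    then have "h (eta T X p) = app A 1 (eta T (V 1) (x 0)) (\<lambda>_. f p)"
      using h_eq[of "eta T (V 1) (x 0)" 1 "\<lambda>_. p"] x0 p by (simp add: eta_pt)
    also have "\<dots> = f p"
      using app_eta[OF A, of 0 1 "\<lambda>_. f p"] fp[OF p] by simp
    finally show ?thesis .
  qed
  ultimately show thesis
    using that by blast
qed


subsection \<open>The adjunction whose monad is the given one\<close>

definition counit :: "('u, nat \<times> 'u) qalg \<Rightarrow> 'u \<Rightarrow> 'u" where
  "counit A = (SOME h. h \<in> alg_hom \<Sigma> (falg (sp A)) A \<and> (\<forall>p\<in>pts (sp A). h (eta T (sp A) p) = p))"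

lemma counit:
  assumes "A \<in> \<V>"
  shows "counit A \<in> alg_hom \<Sigma> (falg (sp A)) A"
    and "\<And>p. p \<in> pts (sp A) \<Longrightarrow> counit A (eta T (sp A) p) = p"
proof -
  have "\<exists>h. h \<in> alg_hom \<Sigma> (falg (sp A)) A \<and> (\<forall>p\<in>pts (sp A). h (eta T (sp A) p) = p)"
    using hom_extension[OF variety_sp[OF assms] assms nex_ident] by (metis restrict_apply')
  from someI_ex[OF this] show "counit A \<in> alg_hom \<Sigma> (falg (sp A)) A"
    and "\<And>p. p \<in> pts (sp A) \<Longrightarrow> counit A (eta T (sp A) p) = p"
    unfolding counit_def by blast+
qed

lemma counit_falg:
  assumes X: "X \<in> K"
  shows "counit (falg X) = mu T X"
  using counit[OF falg_in_variety[OF X]] mu_hom[OF X] X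
  by (intro hom_unique[OF T_in[OF X]]) (simp_all add: mu_eta)

definition Tadj :: "('u, nat \<times> 'u) free_adj" where
  "Tadj = \<lparr>free_ob = falg, free_mp = T\<^sub>1, adj_unit = eta T, adj_counit = counit\<rparr>"

lemma Tadj_free_adjunction: "free_adjunction K \<Sigma> \<V> Tadj"
proof -
  have counit_nat: "compose (pts (T\<^sub>0 (sp A))) (counit B) (T\<^sub>1 (sp A) (sp B) h) =
      compose (pts (T\<^sub>0 (sp A))) h (counit A)"
    if A: "A \<in> \<V>" and B: "B \<in> \<V>" and h: "h \<in> alg_hom \<Sigma> A B" for A B h
  proof -
    note KA = variety_sp[OF A] and KB = variety_sp[OF B] and hn = alg_hom_nex[OF h]
    note falg = falg_quant_alg[OF KA]
    have "compose (pts (sp (falg (sp A)))) (counit B) (T\<^sub>1 (sp A) (sp B) h) =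
        compose (pts (sp (falg (sp A)))) h (counit A)"
      by (rule hom_unique[OF KA alg_hom_compose[OF falg T_hom[OF KA KB hn] counit(1)[OF B]]
            alg_hom_compose[OF falg counit(1)[OF A] h]])
        (simp add: compose_eq eta_pt KA KB eta_natural[OF KA KB hn] counit(2)[OF A] counit(2)[OF B]
          nex_pt[OF hn])
    then show ?thesis
      by simp
  qed
  have triangle: "compose (pts (T\<^sub>0 X)) (counit (falg X)) (T\<^sub>1 X (T\<^sub>0 X) (eta T X)) = ident (T\<^sub>0 X)"
    if "X \<in> K" for X
    by (rule compose_eq_restrict) (simp add: that counit_falg mu_T_eta)
  have triangle': "compose (pts (sp A)) (counit A) (eta T (sp A)) = ident (sp A)" if "A \<in> \<V>" for A
    by (rule compose_eq_restrict) (rule counit(2)[OF that])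
  show ?thesis
    unfolding free_adjunction_def Tadj_def
    using falg_in_variety T_hom functor_law3[THEN conjunct1] functor_law4[THEN conjunct1] functor_law5
      eta_nex monad_law4[THEN conjunct1] counit(1) counit_nat triangle triangle'
    by simp
qed

text \<open>
  The monad of \<open>Tadj\<close> differs from \<open>T\<close> at most in the multiplication at spaces outside the base
  category, which isomorphism of monads does not see.
\<close>

lemma free_monad_iso:
  assumes F: "free_adjunction K \<Sigma> \<V> F"
  shows "monad_iso K (adj_monad F) T"
proof -
  have eqs: "fob (adj_monad Tadj) = T\<^sub>0" "fmp (adj_monad Tadj) = T\<^sub>1" "eta (adj_monad Tadj) = eta T"
    "\<And>X. X \<in> K \<Longrightarrow> mu (adj_monad Tadj) X = mu T X"
    by (simp_all add: adj_monad_def Tadj_def counit_falg)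
  have "monad_iso K S (adj_monad Tadj) \<longleftrightarrow> monad_iso K S T" for S :: "'u emonad"
    unfolding monad_iso_def eqs(1-3) by (simp add: eqs(4) cong: ball_cong)
  then show ?thesis
    using free_adjunctions_monad_iso[OF variety_quant_alg F Tadj_free_adjunction] by simp
qed

end


section \<open>Strongly finitary monads are free-algebra monads\<close>

theorem theorem5p6:
  fixes U :: "'u set set" and K :: "'u emetric set" and T :: "'u emonad" and x :: "nat \<Rightarrow> 'u"
  assumes "small_sets U"
    and "K = Met U \<or> K = UMet U"
    and "inj x"
    and "enriched_monad K T"
    and "strongly_finitary K T"
  shows "(\<exists>F. free_adjunction K (assoc_sig x T) (assoc_variety K x T) F) \<and>
    (\<forall>F. free_adjunction K (assoc_sig x T) (assoc_variety K x T) F \<longrightarrow>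
       monad_iso K (adj_monad F) T)"
proof -
  interpret strongly_finitary_monad K T x
  proof
    show "FinDisc \<subseteq> K"
      by (rule FinDisc_subset[OF assms(1,2)])
    show "ext_metric X" if "X \<in> K" for X
      using that assms(2) unfolding UMet_def Met_def by auto
    show "subsp X Z \<in> K" if "X \<in> K" "Z \<subseteq> pts X" for X Z
      by (rule subspace_in_base[OF assms(1,2) that])
  qed (use assms in auto)
  show ?thesis
    using Tadj_free_adjunction free_monad_iso by blast
qed

end
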